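(* Let $X=C^\infty[0,1]$ be endowed with the topology defined below, and let $Y$ be a real linear topological space. Every bounded-differentiable germ at $0\in C^\infty[0,1]$ of maps from $X$ to $Y$ has a global bounded-differentiable representative, and every compact-differentiable germ at $0\in C^\infty[0,1]$ of maps from $X$ to $Y$ has a global compact-differentiable representative.
   Context: $C^\infty[0,1]$ is the space of infinitely differentiable real functions on $[0,1]$, with the topology defined by the collection of norms $\|x\|_k=\max_{j\le k}\max_{t\in[0,1]}|x^{(j)}(t)|$, $k=0,1,2,\dots$ Germs: two maps into $Y$ defined on neighborhoods of $0\in X$ are equivalent if they coincide on some neighborhood of $0$; a germ at $0$ is an equivalence class, and its members are its representatives. A representative is global if it is defined on all of $X$. A germ is bounded- (resp. compact-) differentiable if it has a representative that is so at every point of its (open) domain; a global representative is bounded- (resp. compact-) differentiable if it is so at every point of $X$. A map $f$ is bounded-differentiable at $x$ if there is a continuous linear operator $A:X\to Y$ such that for every bounded subset $S\subset X$, for $h\in S$ and $t\in\mathbb{R}$, $f(x+th)-f(x)=tAh+r(th)$ with $r(th)/t\to0$ uniformly in $h\in S$ as $t\to0$. It is compact (Hadamard) differentiable at $x$ if there is a continuous linear operator $A:X\to Y$ such that $f(x+t_nh_n)-f(x)=t_nAh+o(t_n)$ whenever $t_n\to0$ in $\mathbb{R}$ and $h_n\to h$ in $X$. *)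

theory Defs
  imports "HOL-Analysis.Analysis"
begin

section \<open>Real linear topological spaces\<close>

text \<open>No separation axiom is imposed.\<close>

class real_tvs = real_vector + topological_ab_group_add +
  assumes tendsto_scaleR_Pair:
    "LIM x (nhds a \<times>\<^sub>F nhds b). fst x *\<^sub>R snd x :> nhds (a *\<^sub>R b)"

instance real_normed_vector < real_tvs
proof
  fix a :: real and b :: 'a
  show "LIM x (nhds a \<times>\<^sub>F nhds b). fst x *\<^sub>R snd x :> nhds (a *\<^sub>R b)"
    by (intro tendsto_scaleR filterlim_fst filterlim_snd)
qed

text \<open>Boundedness in the sense of topological vector spaces: a bounded set is absorbed by every
  neighbourhood of the origin.  This is unrelated to the metric notion \<^const>\<open>bounded\<close>.\<close>

definition tvs_bounded :: "'a::real_tvs set \<Rightarrow> bool" where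
  "tvs_bounded S \<longleftrightarrow>
     (\<forall>V. open V \<and> 0 \<in> V \<longrightarrow> (\<exists>s>0. \<forall>t>s. S \<subseteq> (\<lambda>v. t *\<^sub>R v) ` V))"


section \<open>Differentiability\<close>

text \<open>The remainder is \<open>r v = f (x + v) - f x - A v\<close>.  Both notions only depend on the values of
  \<open>f\<close> in a neighbourhood of \<open>x\<close>.\<close>

definition bounded_differentiable_at :: "('a::real_tvs \<Rightarrow> 'b::real_tvs) \<Rightarrow> 'a \<Rightarrow> bool" where
  "bounded_differentiable_at f x \<longleftrightarrow>
     (\<exists>A. linear A \<and> continuous_on UNIV A \<and>
       (\<forall>S. tvs_bounded S \<longrightarrow>
         (\<forall>V. open V \<and> 0 \<in> V \<longrightarrow>
           (\<forall>\<^sub>F t in at (0::real). \<forall>h\<in>S.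
              (f (x + t *\<^sub>R h) - f x - t *\<^sub>R A h) /\<^sub>R t \<in> V))))"

text \<open>If \<open>t n = 0\<close> the quotient below is \<open>0\<close>, in accordance with the remainder
  being \<open>0\<close> there.\<close>

definition compact_differentiable_at :: "('a::real_tvs \<Rightarrow> 'b::real_tvs) \<Rightarrow> 'a \<Rightarrow> bool" where
  "compact_differentiable_at f x \<longleftrightarrow>
     (\<exists>A. linear A \<and> continuous_on UNIV A \<and>
       (\<forall>(t :: nat \<Rightarrow> real) (hs :: nat \<Rightarrow> 'a) h.
          t \<longlonglongrightarrow> 0 \<and> hs \<longlonglongrightarrow> h \<longrightarrow>
          (\<lambda>n. (f (x + t n *\<^sub>R hs n) - f x - t n *\<^sub>R A h) /\<^sub>R t n) \<longlonglongrightarrow> 0))"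


section \<open>Germs at the origin\<close>

definition local_maps_at_0 :: "('a::real_tvs \<rightharpoonup> 'b) set" where
  "local_maps_at_0 = {f. \<forall>\<^sub>F x in nhds 0. x \<in> dom f}"

definition germ_rel :: "(('a::real_tvs \<rightharpoonup> 'b) \<times> ('a \<rightharpoonup> 'b)) set" where
  "germ_rel = {(f, g). f \<in> local_maps_at_0 \<and> g \<in> local_maps_at_0 \<and>
                       (\<forall>\<^sub>F x in nhds 0. f x = g x)}"

definition germs_at_0 :: "('a::real_tvs \<rightharpoonup> 'b) set set" where
  "germs_at_0 = local_maps_at_0 // germ_rel"

lemma equiv_germ_rel: "equiv local_maps_at_0 germ_rel"
proof (rule equivI)
  show "germ_rel \<subseteq> local_maps_at_0 \<times> local_maps_at_0"
    by (auto simp: germ_rel_def)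
  show "refl_on local_maps_at_0 germ_rel"
    by (auto simp: germ_rel_def refl_on_def)
  show "sym germ_rel"
    by (auto simp: germ_rel_def sym_def eq_commute)
  show "trans germ_rel"
    unfolding germ_rel_def trans_def by (auto elim: eventually_elim2)
qed

definition global_map :: "('a \<rightharpoonup> 'b) \<Rightarrow> bool" where
  "global_map f \<longleftrightarrow> dom f = UNIV"

text \<open>Differentiability of a partial map at every point of its domain.  It is only used for open
  domains, so the values of \<^term>\<open>the (f y)\<close> for \<open>y\<close> outside the domain are irrelevant.\<close>

definition bounded_differentiable_map :: "('a::real_tvs \<rightharpoonup> 'b::real_tvs) \<Rightarrow> bool" where
  "bounded_differentiable_map f \<longleftrightarrow>
     open (dom f) \<and> (\<forall>x\<in>dom f. bounded_differentiable_at (\<lambda>y. the (f y)) x)"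

definition compact_differentiable_map :: "('a::real_tvs \<rightharpoonup> 'b::real_tvs) \<Rightarrow> bool" where
  "compact_differentiable_map f \<longleftrightarrow>
     open (dom f) \<and> (\<forall>x\<in>dom f. compact_differentiable_at (\<lambda>y. the (f y)) x)"

definition bounded_differentiable_germ :: "('a::real_tvs \<rightharpoonup> 'b::real_tvs) set \<Rightarrow> bool" where
  "bounded_differentiable_germ G \<longleftrightarrow> (\<exists>f\<in>G. bounded_differentiable_map f)"

definition compact_differentiable_germ :: "('a::real_tvs \<rightharpoonup> 'b::real_tvs) set \<Rightarrow> bool" where
  "compact_differentiable_germ G \<longleftrightarrow> (\<exists>f\<in>G. compact_differentiable_map f)"


section \<open>The space of smooth functions on the unit interval\<close>

text \<open>Iterated derivatives on \<open>[0,1]\<close>, one-sided at the end points.  Only the values at points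
  of \<open>[0,1]\<close> are meaningful, and they only depend on the restriction of \<open>x\<close> to \<open>[0,1]\<close>.\<close>

definition deriv01 :: "nat \<Rightarrow> (real \<Rightarrow> real) \<Rightarrow> real \<Rightarrow> real" where
  "deriv01 j x = ((\<lambda>g t. vector_derivative g (at t within {0..1})) ^^ j) x"

definition smooth01 :: "(real \<Rightarrow> real) \<Rightarrow> bool" where
  "smooth01 x \<longleftrightarrow> (\<forall>j. deriv01 j x differentiable_on {0..1})"

lemma smooth01_deriv:
  assumes "smooth01 x" "t \<in> {0..1}"
  shows "(deriv01 j x has_vector_derivative deriv01 (Suc j) x t) (at t within {0..1})"
  using assms
  by (auto simp: smooth01_def deriv01_def differentiable_on_def vector_derivative_works[symmetric])

lemma smooth01_characterization:
  assumes "\<And>t. t \<in> {0..1} \<Longrightarrow> D 0 t = x t"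
    and "\<And>j t. t \<in> {0..1} \<Longrightarrow> (D j has_vector_derivative D (Suc j) t) (at t within {0..1})"
  shows "smooth01 x" and "t \<in> {0..1} \<Longrightarrow> deriv01 j x t = D j t"
proof -
  have eq: "\<forall>t\<in>{0..1}. deriv01 j x t = D j t" for j
  proof (induction j)
    case 0
    show ?case using assms(1) by (simp add: deriv01_def)
  next
    case (Suc j)
    show ?case
    proof
      fix t :: real assume t: "t \<in> {0..1}"
      have "(deriv01 j x has_vector_derivative D (Suc j) t) (at t within {0..1})"
        by (rule has_vector_derivative_transform[OF t _ assms(2)[OF t]]) (use Suc in auto)
      from vector_derivative_within_closed_interval[OF _ t this]
      show "deriv01 (Suc j) x t = D (Suc j) t" by (simp add: deriv01_def)
    qed
  qed
  show "smooth01 x"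
    unfolding smooth01_def differentiable_on_def
  proof (intro allI ballI)
    fix j and t :: real assume t: "t \<in> {0..1}"
    have "(deriv01 j x has_vector_derivative D (Suc j) t) (at t within {0..1})"
      by (rule has_vector_derivative_transform[OF t _ assms(2)[OF t]]) (use eq in auto)
    then show "deriv01 j x differentiable at t within {0..1}"
      by (rule differentiableI_vector)
  qed
  show "t \<in> {0..1} \<Longrightarrow> deriv01 j x t = D j t" using eq by blast
qed

lemma smooth01_zero: "smooth01 (\<lambda>t. 0)"
  and deriv01_zero: "t \<in> {0..1} \<Longrightarrow> deriv01 j (\<lambda>t. 0) t = 0"
  by (rule smooth01_characterization[where D = "\<lambda>j t. 0"]; simp)+

lemma smooth01_add: "smooth01 x \<Longrightarrow> smooth01 y \<Longrightarrow> smooth01 (\<lambda>t. x t + y t)"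
  and deriv01_add: "smooth01 x \<Longrightarrow> smooth01 y \<Longrightarrow> t \<in> {0..1} \<Longrightarrow>
        deriv01 j (\<lambda>t. x t + y t) t = deriv01 j x t + deriv01 j y t"
  by (rule smooth01_characterization[where D = "\<lambda>j t. deriv01 j x t + deriv01 j y t"];
      (intro has_vector_derivative_add smooth01_deriv)?; simp add: deriv01_def)+

lemma smooth01_scaleR: "smooth01 x \<Longrightarrow> smooth01 (\<lambda>t. c * x t)"
  and deriv01_scaleR: "smooth01 x \<Longrightarrow> t \<in> {0..1} \<Longrightarrow> deriv01 j (\<lambda>t. c * x t) t = c * deriv01 j x t"
  by (rule smooth01_characterization[where D = "\<lambda>j t. c * deriv01 j x t"];
      (intro has_vector_derivative_mult_right smooth01_deriv)?; simp add: deriv01_def)+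

text \<open>Functions on \<open>[0,1]\<close> are represented by their extension by \<open>0\<close> to the real line.\<close>

typedef smooth_fun01 = "{x. smooth01 x \<and> (\<forall>t. t \<notin> {0..1} \<longrightarrow> x t = 0)}"
  morphisms fun01 Abs_smooth_fun01
  by (rule exI[of _ "\<lambda>t. 0"]) (simp add: smooth01_zero)

setup_lifting type_definition_smooth_fun01

instantiation smooth_fun01 :: real_vector
begin

lift_definition zero_smooth_fun01 :: smooth_fun01 is "\<lambda>t. 0"
  by (simp add: smooth01_zero)

lift_definition plus_smooth_fun01 :: "smooth_fun01 \<Rightarrow> smooth_fun01 \<Rightarrow> smooth_fun01"
  is "\<lambda>x y t. x t + y t"
  by (simp add: smooth01_add)

lift_definition scaleR_smooth_fun01 :: "real \<Rightarrow> smooth_fun01 \<Rightarrow> smooth_fun01"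
  is "\<lambda>c x t. c * x t"
  by (simp add: smooth01_scaleR)

lift_definition uminus_smooth_fun01 :: "smooth_fun01 \<Rightarrow> smooth_fun01" is "\<lambda>x t. - x t"
  using smooth01_scaleR[of _ "-1"] by simp

lift_definition minus_smooth_fun01 :: "smooth_fun01 \<Rightarrow> smooth_fun01 \<Rightarrow> smooth_fun01"
  is "\<lambda>x y t. x t - y t"
  using smooth01_add[OF _ smooth01_scaleR[of _ "-1"]] by simp

instance
  by standard (transfer; simp add: algebra_simps)+

end

definition cnorm :: "nat \<Rightarrow> smooth_fun01 \<Rightarrow> real" where
  "cnorm k x = (MAX j\<in>{..k}. SUP t\<in>{0..1}. \<bar>deriv01 j (fun01 x) t\<bar>)"

lemma smooth01_fun01: "smooth01 (fun01 x)"
  using fun01[of x] by simp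

lemma bdd_above_deriv01: "bdd_above ((\<lambda>t. \<bar>deriv01 j (fun01 x) t\<bar>) ` {0..1})"
proof -
  have "continuous_on {0..1} (deriv01 j (fun01 x))"
    using smooth01_fun01[of x] differentiable_imp_continuous_on by (auto simp: smooth01_def)
  then have "compact ((\<lambda>t. \<bar>deriv01 j (fun01 x) t\<bar>) ` {0..1})"
    by (intro compact_continuous_image continuous_intros) auto
  then show ?thesis by (simp add: bounded_imp_bdd_above compact_imp_bounded)
qed

lemma cnorm_le_iff:
  "cnorm k x \<le> c \<longleftrightarrow> (\<forall>j\<le>k. \<forall>t\<in>{0..1}. \<bar>deriv01 j (fun01 x) t\<bar> \<le> c)"
  by (auto simp: cnorm_def cSUP_le_iff[OF _ bdd_above_deriv01])

lemma deriv01_le_cnorm: "j \<le> k \<Longrightarrow> t \<in> {0..1} \<Longrightarrow> \<bar>deriv01 j (fun01 x) t\<bar> \<le> cnorm k x"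
  using cnorm_le_iff by blast

lemma cnorm_nonneg: "0 \<le> cnorm k x"
  using deriv01_le_cnorm[of 0 k 0 x] by auto

lemma cnorm_zero [simp]: "cnorm k 0 = 0"
  by (rule antisym[OF _ cnorm_nonneg])
     (auto simp: cnorm_le_iff zero_smooth_fun01.rep_eq deriv01_zero)

lemma cnorm_triangle: "cnorm k (x + y) \<le> cnorm k x + cnorm k y"
  unfolding cnorm_le_iff
  using deriv01_le_cnorm[of _ k _ x] deriv01_le_cnorm[of _ k _ y]
  by (auto simp: plus_smooth_fun01.rep_eq deriv01_add smooth01_fun01
      intro!: order_trans[OF abs_triangle_ineq] add_mono)

lemma cnorm_scaleR_le: "cnorm k (c *\<^sub>R x) \<le> \<bar>c\<bar> * cnorm k x"
  unfolding cnorm_le_iff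
  using deriv01_le_cnorm[of _ k _ x]
  by (auto simp: scaleR_smooth_fun01.rep_eq deriv01_scaleR smooth01_fun01 abs_mult
      intro!: mult_left_mono)

lemma cnorm_uminus: "cnorm k (- x) = cnorm k x"
  using cnorm_scaleR_le[of k "-1" x] cnorm_scaleR_le[of k "-1" "-x"] by simp

lemma cnorm_mono: "k \<le> l \<Longrightarrow> cnorm k x \<le> cnorm l x"
  unfolding cnorm_le_iff using deriv01_le_cnorm[of _ l] by auto

text \<open>The topology defined by the norms \<open>cnorm k\<close>.  As these increase with \<open>k\<close>, the balls
  of single norms form a base of neighbourhoods.\<close>

instantiation smooth_fun01 :: topological_space
begin

definition open_smooth_fun01 :: "smooth_fun01 set \<Rightarrow> bool" where
  "open_smooth_fun01 U \<longleftrightarrow>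
     (\<forall>x\<in>U. \<exists>k. \<exists>e>0. \<forall>y. cnorm k (y - x) < e \<longrightarrow> y \<in> U)"

instance
proof
  show "open (UNIV :: smooth_fun01 set)"
    by (auto simp: open_smooth_fun01_def intro: zero_less_one)
next
  fix S T :: "smooth_fun01 set"
  assume "open S" "open T"
  show "open (S \<inter> T)"
    unfolding open_smooth_fun01_def
  proof
    fix x assume "x \<in> S \<inter> T"
    then have "x \<in> S" "x \<in> T" by auto
    obtain k e where e: "e > 0" "\<And>y. cnorm k (y - x) < e \<Longrightarrow> y \<in> S"
      using \<open>open S\<close> \<open>x \<in> S\<close> unfolding open_smooth_fun01_def by blast
    obtain l d where d: "d > 0" "\<And>y. cnorm l (y - x) < d \<Longrightarrow> y \<in> T"
      using \<open>open T\<close> \<open>x \<in> T\<close> unfolding open_smooth_fun01_def by blast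
    note * = e d
    have "y \<in> S \<inter> T" if "cnorm (max k l) (y - x) < min e d" for y
      using * that cnorm_mono[of k "max k l" "y - x"] cnorm_mono[of l "max k l" "y - x"] by auto
    then show "\<exists>k. \<exists>e>0. \<forall>y. cnorm k (y - x) < e \<longrightarrow> y \<in> S \<inter> T"
      using * by (intro exI[of _ "max k l"] exI[of _ "min e d"]) auto
  qed
next
  fix K :: "smooth_fun01 set set"
  assume "\<forall>S\<in>K. open S"
  then show "open (\<Union>K)"
    unfolding open_smooth_fun01_def by fast
qed

end

lemma open_cnorm_ball: "open {y. cnorm k (y - x) < e}"
  unfolding open_smooth_fun01_def
proof
  fix z assume z: "z \<in> {y. cnorm k (y - x) < e}"
  have "cnorm k (y - x) < e" if "cnorm k (y - z) < e - cnorm k (z - x)" for y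
    using cnorm_triangle[of k "y - z" "z - x"] that by simp
  with z show "\<exists>l. \<exists>d>0. \<forall>y. cnorm l (y - z) < d \<longrightarrow> y \<in> {y. cnorm k (y - x) < e}"
    by (intro exI[of _ k] exI[of _ "e - cnorm k (z - x)"]) simp
qed

lemma tendsto_smooth_fun01_iff:
  "(f \<longlongrightarrow> x) F \<longleftrightarrow> (\<forall>k. ((\<lambda>z. cnorm k (f z - x)) \<longlongrightarrow> 0) F)"
proof
  assume L: "(f \<longlongrightarrow> x) F"
  show "\<forall>k. ((\<lambda>z. cnorm k (f z - x)) \<longlongrightarrow> 0) F"
  proof
    fix k
    have "\<forall>\<^sub>F z in F. cnorm k (f z - x) < e" if "e > 0" for e
      using topological_tendstoD[OF L open_cnorm_ball[of k x e]] that by simp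
    then show "((\<lambda>z. cnorm k (f z - x)) \<longlongrightarrow> 0) F"
      by (simp add: tendsto_iff dist_real_def cnorm_nonneg)
  qed
next
  assume R: "\<forall>k. ((\<lambda>z. cnorm k (f z - x)) \<longlongrightarrow> 0) F"
  show "(f \<longlongrightarrow> x) F"
  proof (rule topological_tendstoI)
    fix S assume "open S" "x \<in> S"
    then obtain k e where "e > 0" and S: "\<And>y. cnorm k (y - x) < e \<Longrightarrow> y \<in> S"
      unfolding open_smooth_fun01_def by blast
    from order_tendstoD(2)[OF R[rule_format, of k] \<open>e > 0\<close>]
    show "\<forall>\<^sub>F z in F. f z \<in> S" by (rule eventually_mono) (rule S)
  qed
qed

instance smooth_fun01 :: real_tvs
proof
  fix a b :: smooth_fun01
  let ?F = "nhds a \<times>\<^sub>F nhds b"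
  have 1: "((\<lambda>z. cnorm k (fst z - a)) \<longlongrightarrow> 0) ?F" "((\<lambda>z. cnorm k (snd z - b)) \<longlongrightarrow> 0) ?F" for k
    using filterlim_fst[of "nhds a" "nhds b"] filterlim_snd[of "nhds b" "nhds a"]
    unfolding tendsto_smooth_fun01_iff by auto
  show "LIM x ?F. fst x + snd x :> nhds (a + b)"
    unfolding tendsto_smooth_fun01_iff
  proof
    fix k
    have "cnorm k (fst z + snd z - (a + b)) \<le> cnorm k (fst z - a) + cnorm k (snd z - b)" for z
      using cnorm_triangle[of k "fst z - a" "snd z - b"] by (simp add: algebra_simps)
    then show "((\<lambda>z. cnorm k (fst z + snd z - (a + b))) \<longlongrightarrow> 0) ?F"
      by (intro tendsto_sandwich[OF _ _ tendsto_const tendsto_add_zero[OF 1(1)[of k] 1(2)[of k]]])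
         (auto simp: cnorm_nonneg)
  qed
next
  fix a :: smooth_fun01
  have *: "cnorm k (- z - - a) = cnorm k (z - a)" for k z
    using cnorm_uminus[of k "z - a"] by simp
  have "((\<lambda>z. z) \<longlongrightarrow> a) (nhds a)" by (rule filterlim_ident)
  then show "(uminus \<longlongrightarrow> - a) (nhds a)"
    unfolding tendsto_smooth_fun01_iff * .
next
  fix a :: real and b :: smooth_fun01
  let ?F = "nhds a \<times>\<^sub>F nhds b"
  have f: "(fst \<longlongrightarrow> a) ?F" by (rule filterlim_fst)
  have s: "((\<lambda>z. cnorm k (snd z - b)) \<longlongrightarrow> 0) ?F" for k
    using filterlim_snd[of "nhds b" "nhds a"] unfolding tendsto_smooth_fun01_iff by auto
  show "LIM x ?F. fst x *\<^sub>R snd x :> nhds (a *\<^sub>R b)"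
    unfolding tendsto_smooth_fun01_iff
  proof
    fix k
    let ?g = "\<lambda>z. \<bar>fst z\<bar> * cnorm k (snd z - b) + \<bar>fst z - a\<bar> * cnorm k b"
    have le: "cnorm k (fst z *\<^sub>R snd z - a *\<^sub>R b) \<le> ?g z" for z
    proof -
      have "fst z *\<^sub>R snd z - a *\<^sub>R b = fst z *\<^sub>R (snd z - b) + (fst z - a) *\<^sub>R b"
        by (simp add: algebra_simps)
      then show ?thesis
        using cnorm_triangle[of k "fst z *\<^sub>R (snd z - b)" "(fst z - a) *\<^sub>R b"]
          cnorm_scaleR_le[of k "fst z" "snd z - b"] cnorm_scaleR_le[of k "fst z - a" b]
        by simp
    qed
    have lim: "(?g \<longlongrightarrow> 0) ?F"
      using tendsto_add[OF tendsto_mult[OF tendsto_rabs[OF f] s[of k]]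
          tendsto_mult[OF tendsto_rabs[OF tendsto_diff[OF f tendsto_const[of a]]]
            tendsto_const[of "cnorm k b"]]]
      by simp
    show "((\<lambda>z. cnorm k (fst z *\<^sub>R snd z - a *\<^sub>R b)) \<longlongrightarrow> 0) ?F"
      by (rule Lim_null_comparison[OF always_eventually lim]) (use le in \<open>simp add: cnorm_nonneg\<close>)
  qed
qed

end

theory Submission
  imports Defs
begin

text \<open>A germ is extended by composing a representative with a localization: a bounded-differentiable
  map \<open>H\<close> of the space of smooth functions into itself whose values lie in the domain \<open>U\<close> of
  the representative \<open>f\<close> and which is the identity near the origin.  Then \<open>f \<circ> H\<close> is
  defined everywhere, agrees with \<open>f\<close> near the origin, and is differentiable by the chain rule.  For
  compact differentiability the chain rule applies as well, because bounded differentiability implies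
  compact differentiability.

  To find \<open>H\<close>, choose \<open>k\<close> such that \<open>U\<close> contains a ball of the norm of order \<open>k\<close>, and a smooth
  bounded function \<open>h\<close> on the real line with \<open>h s = s\<close> near \<open>0\<close>.  Let
  \<open>H\<^sub>0 x = h \<circ> x\<close> and \<open>H\<^sub>k\<^sub>+\<^sub>1 x = h (x 0) + \<integral> H\<^sub>k x'\<close>, the integral taken from \<open>0\<close>.  As
  \<open>x = x 0 + \<integral> x'\<close>, the operator \<open>H\<^sub>k\<close> is the identity on a ball of the norm of order \<open>k\<close>.
  Moreover, the norm of order \<open>k\<close> of \<open>H\<^sub>k x\<close> is at most \<open>k + 1\<close> times the bound
  of \<open>h\<close>, so that a small bound keeps the values in \<open>U\<close> (\<open>cutoff_eq_self\<close>, \<open>cnorm_cutoff_le\<close>).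

  Differentiation, integration and evaluation at \<open>0\<close> are continuous and linear, so the differentiability
  of \<open>H\<^sub>k\<close> reduces to that of the superposition operator \<open>x \<mapsto> h \<circ> x\<close>.  Its remainder at order \<open>0\<close> is
  controlled by Taylor's formula, and the higher norms follow by induction, as the derivative
  of the remainder for \<open>h\<close> is a combination of the remainder for \<open>h'\<close> and small terms
  (\<open>superpose_remainder_tendsto_0\<close>).

  Both notions of differentiability are treated through sequences of directions, bounded ones and convergent
  ones.  The chain rule then takes one short computation (\<open>differentiable_along_compose\<close>).\<close>


section \<open>Differentiability along sequences\<close>

lemma tendsto_scaleR_tvs:
  fixes g :: "'b \<Rightarrow> 'a::real_tvs"
  assumes "(f \<longlongrightarrow> a) F" "(g \<longlongrightarrow> b) F"
  shows "((\<lambda>x. f x *\<^sub>R g x) \<longlongrightarrow> a *\<^sub>R b) F"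
  using filterlim_compose[OF tendsto_scaleR_Pair filterlim_Pair[OF assms]] by simp

text \<open>If \<open>V\<close> fails to absorb \<open>S\<close>, then some
  points \<open>s n\<close> of \<open>S\<close> lie outside \<open>t n *\<^sub>R V\<close> with \<open>t n\<close> tending to infinity, and the sequence
  \<open>s n /\<^sub>R t n\<close> stays out of \<open>V\<close>.  Conversely, a set that is absorbed by \<open>V \<inter> - V\<close> is
  carried into \<open>V\<close> by all scalars close to \<open>0\<close>, whatever their sign.\<close>

lemma tvs_bounded_iff_sequentially:
  "tvs_bounded S \<longleftrightarrow>
     (\<forall>s c. range s \<subseteq> S \<and> c \<longlonglongrightarrow> 0 \<longrightarrow> (\<lambda>n. c n *\<^sub>R s n) \<longlonglongrightarrow> 0)"
proof (intro iffI allI impI; (elim conjE)?)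
  fix s :: "nat \<Rightarrow> 'a" and c :: "nat \<Rightarrow> real"
  assume S: "tvs_bounded S" and s: "range s \<subseteq> S" and c: "c \<longlonglongrightarrow> 0"
  show "(\<lambda>n. c n *\<^sub>R s n) \<longlonglongrightarrow> 0"
  proof (rule topological_tendstoI)
    fix V :: "'a set"
    assume V: "open V" "0 \<in> V"
    have "open (uminus -` V)"
      by (rule open_vimage[OF V(1)]) (intro continuous_intros)
    then have "open (V \<inter> uminus -` V)" "0 \<in> V \<inter> uminus -` V"
      using V by auto
    then obtain b where b: "b > 0" "\<And>t. t > b \<Longrightarrow> S \<subseteq> (\<lambda>v. t *\<^sub>R v) ` (V \<inter> uminus -` V)"
      using S unfolding tvs_bounded_def by blast
    have "\<forall>\<^sub>F n in sequentially. \<bar>c n\<bar> < inverse b"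
      using order_tendstoD(2)[OF tendsto_rabs_zero[OF c], of "inverse b"] b(1) by simp
    then show "\<forall>\<^sub>F n in sequentially. c n *\<^sub>R s n \<in> V"
    proof eventually_elim
      case (elim n)
      show ?case
      proof (cases "c n = 0")
        case False
        then have "b < inverse \<bar>c n\<bar>"
          using elim b(1) less_imp_inverse_less[of "\<bar>c n\<bar>" "inverse b"] by simp
        then obtain v where v: "v \<in> V" "- v \<in> V" "s n = inverse \<bar>c n\<bar> *\<^sub>R v"
          using b(2)[of "inverse \<bar>c n\<bar>"] s by (auto simp: image_subset_iff)
        have "c n *\<^sub>R s n = (if c n > 0 then v else - v)"
          using False v(3) by (auto simp: divide_simps)
        then show ?thesis
          using v by simp
      qed (use V in simp)
    qed
  qed
next
  assume *: "\<forall>s c. range s \<subseteq> S \<and> c \<longlonglongrightarrow> 0 \<longrightarrow> (\<lambda>n. c n *\<^sub>R s n) \<longlonglongrightarrow> 0"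
  show "tvs_bounded S"
    unfolding tvs_bounded_def
  proof (intro allI impI)
    fix V :: "'a set"
    assume V: "open V \<and> 0 \<in> V"
    show "\<exists>b>0. \<forall>t>b. S \<subseteq> (\<lambda>v. t *\<^sub>R v) ` V"
    proof (rule ccontr)
      assume not: "\<not> ?thesis"
      have "\<exists>t x. real (Suc n) < t \<and> x \<in> S \<and> x \<notin> (\<lambda>v. t *\<^sub>R v) ` V" for n
        using not by (meson of_nat_0_less_iff subsetI zero_less_Suc)
      then obtain t x where tx: "\<And>n. real (Suc n) < t n" "\<And>n. x n \<in> S"
        "\<And>n. x n \<notin> (\<lambda>v. t n *\<^sub>R v) ` V"
        by metis
      have t0: "t n > 0" for n
        using tx(1)[of n] by linarith
      have "(\<lambda>n. inverse (t n)) \<longlonglongrightarrow> 0"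
      proof (rule Lim_null_comparison[OF always_eventually LIMSEQ_inverse_real_of_nat], intro allI)
        show "norm (inverse (t n)) \<le> inverse (real (Suc n))" for n
          using tx(1)[of n] t0[of n] by (simp add: le_imp_inverse_le)
      qed
      then have "(\<lambda>n. inverse (t n) *\<^sub>R x n) \<longlonglongrightarrow> 0"
        using * tx(2) by blast
      then have "\<forall>\<^sub>F n in sequentially. inverse (t n) *\<^sub>R x n \<in> V"
        using V topological_tendstoD by blast
      then obtain n where "inverse (t n) *\<^sub>R x n \<in> V"
        by (auto dest: eventually_happens)
      moreover have "x n = t n *\<^sub>R (inverse (t n) *\<^sub>R x n)"
        using t0[of n] by simp
      ultimately show False
        using tx(3)[of n] by blast
    qed
  qed
qed

lemma tvs_bounded_range_iff:
  fixes h :: "'i \<Rightarrow> 'a::real_tvs"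
  shows
  "tvs_bounded (range h) \<longleftrightarrow>
     (\<forall>m c. c \<longlonglongrightarrow> 0 \<longrightarrow> (\<lambda>n. c n *\<^sub>R h (m n)) \<longlonglongrightarrow> 0)"
  (is "_ \<longleftrightarrow> ?R")
proof
  assume ?R
  show "tvs_bounded (range h)"
    unfolding tvs_bounded_iff_sequentially
  proof (intro allI impI; elim conjE)
    fix s :: "nat \<Rightarrow> 'a" and c :: "nat \<Rightarrow> real"
    assume "range s \<subseteq> range h" "c \<longlonglongrightarrow> 0"
    then have "\<forall>n. \<exists>i. s n = h i"
      by (metis rangeE rangeI subsetD)
    then obtain m where "\<And>n. s n = h (m n)"
      by metis
    then show "(\<lambda>n. c n *\<^sub>R s n) \<longlonglongrightarrow> 0"
      using \<open>?R\<close> \<open>c \<longlonglongrightarrow> 0\<close> by simp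
  qed
next
  assume h: "tvs_bounded (range h)"
  show ?R
  proof (intro allI impI)
    fix m :: "nat \<Rightarrow> 'i" and c :: "nat \<Rightarrow> real"
    assume "c \<longlonglongrightarrow> 0"
    moreover have "range (\<lambda>n. h (m n)) \<subseteq> range h"
      by auto
    ultimately show "(\<lambda>n. c n *\<^sub>R h (m n)) \<longlonglongrightarrow> 0"
      using h[unfolded tvs_bounded_iff_sequentially, rule_format, of "\<lambda>n. h (m n)" c] by simp
  qed
qed

text \<open>The tail of a convergent sequence is absorbed because multiplication by scalars is jointly
  continuous at \<open>(0, l)\<close>; each of the finitely many remaining points is absorbed by itself.\<close>

lemma tvs_bounded_range_of_tendsto:
  fixes h :: "nat \<Rightarrow> 'a::real_tvs"
  assumes "h \<longlonglongrightarrow> l"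
  shows "tvs_bounded (range h)"
  unfolding tvs_bounded_range_iff
proof (intro allI impI topological_tendstoI)
  fix m c and V :: "'a set"
  assume c: "c \<longlonglongrightarrow> (0::real)" and V: "open V" "0 \<in> V"
  have "\<forall>\<^sub>F z in nhds 0 \<times>\<^sub>F nhds l. fst z *\<^sub>R snd z \<in> V"
    using topological_tendstoD[OF tendsto_scaleR_Pair[of 0 l]] V by simp
  then obtain P Q where PQ: "eventually P (nhds 0)" "eventually Q (nhds l)"
    "\<And>a b. P a \<Longrightarrow> Q b \<Longrightarrow> a *\<^sub>R b \<in> V"
    unfolding eventually_prod_filter by auto
  have "\<forall>\<^sub>F n in sequentially. Q (h n)"
    using PQ(2) assms by (simp add: filterlim_iff)
  then obtain N where N: "\<And>n. n \<ge> N \<Longrightarrow> Q (h n)"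
    by (auto simp: eventually_sequentially)
  have "\<forall>\<^sub>F n in sequentially. P (c n)"
    using PQ(1) c by (simp add: filterlim_iff)
  moreover have "\<forall>\<^sub>F n in sequentially. \<forall>i\<in>{..<N}. c n *\<^sub>R h i \<in> V"
  proof (intro eventually_ball_finite finite_lessThan ballI)
    fix i
    show "\<forall>\<^sub>F n in sequentially. c n *\<^sub>R h i \<in> V"
      using topological_tendstoD[OF tendsto_scaleR_tvs[OF c tendsto_const[of "h i"]]] V by simp
  qed
  ultimately show "\<forall>\<^sub>F n in sequentially. c n *\<^sub>R h (m n) \<in> V"
  proof eventually_elim
    case (elim n)
    then show ?case
      using N[of "m n"] PQ(3)[of "c n" "h (m n)"] by (cases "m n < N") auto
  qed
qed

lemma tendsto_linear:
  assumes "continuous_on UNIV A" "(f \<longlongrightarrow> a) F"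
  shows "((\<lambda>x. A (f x)) \<longlongrightarrow> A a) F"
  using continuous_on_tendsto_compose[OF assms] by simp

text \<open>This is what the chain rule needs to know about bounded sequences: along increments \<open>h n\<close>, a
  differentiable map moves by directions \<open>A (h n) + r n\<close> with \<open>r\<close> a null sequence.\<close>

lemma tvs_bounded_range_linear_plus_null:
  fixes h :: "nat \<Rightarrow> 'a::real_tvs" and r :: "nat \<Rightarrow> 'b::real_tvs"
  assumes A: "linear A" "continuous_on UNIV A" and h: "tvs_bounded (range h)" and r: "r \<longlonglongrightarrow> 0"
  shows "tvs_bounded (range (\<lambda>n. A (h n) + r n))"
  unfolding tvs_bounded_range_iff
proof (intro allI impI)
  fix m and c :: "nat \<Rightarrow> real"
  assume c: "c \<longlonglongrightarrow> 0"
  have "(\<lambda>n. A (c n *\<^sub>R h (m n))) \<longlonglongrightarrow> A 0"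
    using h c unfolding tvs_bounded_range_iff by (intro tendsto_linear[OF A(2)]) blast
  moreover have "(\<lambda>n. c n *\<^sub>R r (m n)) \<longlonglongrightarrow> 0"
    using tvs_bounded_range_of_tendsto[OF r] c unfolding tvs_bounded_range_iff by blast
  ultimately have "(\<lambda>n. A (c n *\<^sub>R h (m n)) + c n *\<^sub>R r (m n)) \<longlonglongrightarrow> A 0 + 0"
    by (rule tendsto_add)
  then show "(\<lambda>n. c n *\<^sub>R (A (h (m n)) + r (m n))) \<longlonglongrightarrow> 0"
    using A(1) by (simp add: linear_scale linear_0 scaleR_add_right)
qed

text \<open>At \<open>t = 0\<close> the value is \<open>0\<close>, as for the quotients in the two notions of differentiability.
  Therefore null sequences \<open>t\<close> may have vanishing members.\<close>

definition remainder_quotient ::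
  "('a::real_tvs \<Rightarrow> 'b::real_tvs) \<Rightarrow> ('a \<Rightarrow> 'b) \<Rightarrow> 'a \<Rightarrow> real \<Rightarrow> 'a \<Rightarrow> 'b" where
  "remainder_quotient f A x t h = (f (x + t *\<^sub>R h) - f x - t *\<^sub>R A h) /\<^sub>R t"

lemma remainder_quotient_0 [simp]: "remainder_quotient f A x 0 h = 0"
  by (simp add: remainder_quotient_def)

lemma remainder_quotient_expand: "f (x + t *\<^sub>R h) = f x + t *\<^sub>R (A h + remainder_quotient f A x t h)"
  by (cases "t = 0") (simp_all add: remainder_quotient_def algebra_simps)

text \<open>Both notions of differentiability have this form, with the bounded sequences and the convergent
  sequences as the admissible sequences \<open>P\<close> of directions.  The chain rule can thus be proved once.\<close>

definition differentiable_along ::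
  "((nat \<Rightarrow> 'a) \<Rightarrow> bool) \<Rightarrow> ('a::real_tvs \<Rightarrow> 'b::real_tvs) \<Rightarrow> 'a \<Rightarrow> bool" where
  "differentiable_along P f x \<longleftrightarrow>
     (\<exists>A. linear A \<and> continuous_on UNIV A \<and>
       (\<forall>t h. t \<longlonglongrightarrow> 0 \<and> P h \<longrightarrow> (\<lambda>n. remainder_quotient f A x (t n) (h n)) \<longlonglongrightarrow> 0))"

lemma differentiable_alongI:
  assumes "linear A" "continuous_on UNIV A"
    and "\<And>t h. t \<longlonglongrightarrow> 0 \<Longrightarrow> P h \<Longrightarrow> (\<lambda>n. remainder_quotient f A x (t n) (h n)) \<longlonglongrightarrow> 0"
  shows "differentiable_along P f x"
  unfolding differentiable_along_def using assms by blast

lemma differentiable_alongE: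
  assumes "differentiable_along P f x"
  obtains A where "linear A" "continuous_on UNIV A"
    "\<And>t h. t \<longlonglongrightarrow> 0 \<Longrightarrow> P h \<Longrightarrow> (\<lambda>n. remainder_quotient f A x (t n) (h n)) \<longlonglongrightarrow> 0"
  using assms unfolding differentiable_along_def by blast

text \<open>Uniformity over a bounded set can be tested on sequences because the scalar \<open>t\<close> ranges over a
  first countable space: a failure of uniformity yields \<open>t n\<close> tending to \<open>0\<close> and directions \<open>h n\<close> in
  the bounded set whose remainder quotients stay out of a neighbourhood of \<open>0\<close>.\<close>

lemma bounded_differentiable_at_iff:
  "bounded_differentiable_at f x \<longleftrightarrow> differentiable_along (\<lambda>h. tvs_bounded (range h)) f x"
proof
  assume "bounded_differentiable_at f x"
  then obtain A where A: "linear A" "continuous_on UNIV A"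
    and ev: "\<And>S V. tvs_bounded S \<Longrightarrow> open V \<Longrightarrow> 0 \<in> V \<Longrightarrow>
      \<forall>\<^sub>F t in at 0. \<forall>h\<in>S. remainder_quotient f A x t h \<in> V"
    unfolding bounded_differentiable_at_def remainder_quotient_def by blast
  from A show "differentiable_along (\<lambda>h. tvs_bounded (range h)) f x"
  proof (rule differentiable_alongI, intro topological_tendstoI)
    fix t :: "nat \<Rightarrow> real" and h :: "nat \<Rightarrow> 'a" and V :: "'b set"
    assume t: "t \<longlonglongrightarrow> 0" and h: "tvs_bounded (range h)" and V: "open V" "0 \<in> V"
    have "\<forall>\<^sub>F s in nhds 0. s \<noteq> 0 \<longrightarrow> (\<forall>n. remainder_quotient f A x s (h n) \<in> V)"
      using ev[OF h V] by (simp add: eventually_at_filter)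
    then have "\<forall>\<^sub>F n in sequentially. t n \<noteq> 0 \<longrightarrow> (\<forall>m. remainder_quotient f A x (t n) (h m) \<in> V)"
      using t[unfolded filterlim_iff] by blast
    then show "\<forall>\<^sub>F n in sequentially. remainder_quotient f A x (t n) (h n) \<in> V"
    proof eventually_elim
      case (elim n)
      then show ?case
        using V(2) by (cases "t n = 0") simp_all
    qed
  qed
next
  assume "differentiable_along (\<lambda>h. tvs_bounded (range h)) f x"
  then obtain A where A: "linear A" "continuous_on UNIV A"
    and lim: "\<And>t h. t \<longlonglongrightarrow> 0 \<Longrightarrow> tvs_bounded (range h) \<Longrightarrow>
      (\<lambda>n. remainder_quotient f A x (t n) (h n)) \<longlonglongrightarrow> 0"
    by (rule differentiable_alongE) blast
  have "\<forall>\<^sub>F t in at 0. \<forall>h\<in>S. remainder_quotient f A x t h \<in> V"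
    if S: "tvs_bounded S" and V: "open V" "0 \<in> V" for S V
  proof (rule ccontr)
    assume not: "\<not> ?thesis"
    have "\<exists>t h. \<bar>t\<bar> < inverse (real (Suc n)) \<and> h \<in> S \<and> remainder_quotient f A x t h \<notin> V" for n
    proof -
      have "inverse (real (Suc n)) > 0"
        by simp
      with not have "\<not> (\<forall>t\<in>UNIV. t \<noteq> 0 \<and> dist t 0 < inverse (real (Suc n)) \<longrightarrow>
          (\<forall>h\<in>S. remainder_quotient f A x t h \<in> V))"
        unfolding eventually_at by blast
      then show ?thesis
        by (auto simp: dist_real_def)
    qed
    then obtain t h where th: "\<And>n. \<bar>t n\<bar> < inverse (real (Suc n))" "\<And>n. h n \<in> S"
      "\<And>n. remainder_quotient f A x (t n) (h n) \<notin> V"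
      by metis
    have "t \<longlonglongrightarrow> 0"
      by (rule Lim_null_comparison[OF always_eventually LIMSEQ_inverse_real_of_nat])
         (use th(1) in \<open>auto intro: less_imp_le\<close>)
    moreover have "tvs_bounded (range h)"
      using S th(2) unfolding tvs_bounded_iff_sequentially[of S] tvs_bounded_range_iff
      by (simp add: image_subset_iff)
    ultimately have "\<forall>\<^sub>F n in sequentially. remainder_quotient f A x (t n) (h n) \<in> V"
      using lim V topological_tendstoD by blast
    then show False
      using th(3) by simp
  qed
  then show "bounded_differentiable_at f x"
    unfolding bounded_differentiable_at_def remainder_quotient_def using A by blast
qed

text \<open>Replacing \<open>A l\<close>, where \<open>l\<close> is the limit of \<open>h\<close>, by \<open>A (h n)\<close> changes the quotients by a
  null sequence, since \<open>A\<close> is continuous.\<close>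

lemma compact_differentiable_at_iff:
  "compact_differentiable_at f x \<longleftrightarrow> differentiable_along convergent f x"
proof -
  have iff: "(\<lambda>n. (f (x + t n *\<^sub>R h n) - f x - t n *\<^sub>R A l) /\<^sub>R t n) \<longlonglongrightarrow> 0 \<longleftrightarrow>
      (\<lambda>n. remainder_quotient f A x (t n) (h n)) \<longlonglongrightarrow> 0" (is "?Q \<longlonglongrightarrow> 0 \<longleftrightarrow> ?E \<longlonglongrightarrow> 0")
    if A: "continuous_on UNIV A" and h: "h \<longlonglongrightarrow> l" for A t h l
  proof -
    \<comment> \<open>where \<open>t n = 0\<close> both quotients vanish, so that they do not differ by \<open>A (h n) - A l\<close>\<close>
    define d where "d n = (if t n = 0 then 0 else A (h n) - A l)" for n
    have "(\<lambda>n. A (h n) - A l) \<longlonglongrightarrow> A l - A l"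
      by (intro tendsto_diff tendsto_linear[OF A h] tendsto_const)
    then have d: "d \<longlonglongrightarrow> 0"
      unfolding d_def tendsto_def by (auto elim!: eventually_mono)
    have Q: "?Q n = ?E n + d n" for n
      by (cases "t n = 0") (simp_all add: remainder_quotient_def d_def algebra_simps)
    show ?thesis
      using tendsto_add[OF _ d, of ?E 0] tendsto_diff[OF _ d, of ?Q 0] by (auto simp: Q)
  qed
  show ?thesis
  proof
    assume "compact_differentiable_at f x"
    then show "differentiable_along convergent f x"
      unfolding compact_differentiable_at_def differentiable_along_def convergent_def
      using iff by blast
  next
    assume "differentiable_along convergent f x"
    then show "compact_differentiable_at f x"
      unfolding compact_differentiable_at_def differentiable_along_def convergent_def
      using iff by blast
  qed
qed

lemma differentiable_along_mono:
  "differentiable_along P f x \<Longrightarrow> (\<And>h. Q h \<Longrightarrow> P h) \<Longrightarrow> differentiable_along Q f x"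
  unfolding differentiable_along_def by blast

lemma bounded_imp_compact_differentiable_at:
  "bounded_differentiable_at f x \<Longrightarrow> compact_differentiable_at f x"
  unfolding bounded_differentiable_at_iff compact_differentiable_at_iff
  by (erule differentiable_along_mono) (auto simp: convergent_def intro: tvs_bounded_range_of_tendsto)

text \<open>If \<open>r n\<close> is the remainder quotient of \<open>g\<close>, then \<open>g\<close> moves from \<open>g x\<close> by \<open>t n *\<^sub>R (A (h n) + r n)\<close>
  exactly.  Hence the remainder quotient of the composition is that of \<open>f\<close> in the direction
  \<open>A (h n) + r n\<close>, plus \<open>B (r n)\<close>.\<close>

lemma differentiable_along_compose:
  assumes g: "differentiable_along P g x" and f: "differentiable_along Q f (g x)"
    and PQ: "\<And>A h r. linear A \<Longrightarrow> continuous_on UNIV A \<Longrightarrow> P h \<Longrightarrow> r \<longlonglongrightarrow> 0 \<Longrightarrow>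
      Q (\<lambda>n. A (h n) + r n)"
  shows "differentiable_along P (\<lambda>y. f (g y)) x"
proof -
  from g obtain A where A: "linear A" "continuous_on UNIV A"
    and gA: "\<And>t h. t \<longlonglongrightarrow> 0 \<Longrightarrow> P h \<Longrightarrow> (\<lambda>n. remainder_quotient g A x (t n) (h n)) \<longlonglongrightarrow> 0"
    by (rule differentiable_alongE) blast
  from f obtain B where B: "linear B" "continuous_on UNIV B"
    and fB: "\<And>t h. t \<longlonglongrightarrow> 0 \<Longrightarrow> Q h \<Longrightarrow> (\<lambda>n. remainder_quotient f B (g x) (t n) (h n)) \<longlonglongrightarrow> 0"
    by (rule differentiable_alongE) blast
  show ?thesis
  proof (rule differentiable_alongI)
    show "linear (\<lambda>h. B (A h))"
      using linear_compose[OF A(1) B(1)] by (simp add: o_def)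
    show "continuous_on UNIV (\<lambda>h. B (A h))"
      using continuous_on_compose2[OF B(2) A(2)] by simp
    fix t :: "nat \<Rightarrow> real" and h
    assume t: "t \<longlonglongrightarrow> 0" and h: "P h"
    define r where "r n = remainder_quotient g A x (t n) (h n)" for n
    have r: "r \<longlonglongrightarrow> 0"
      unfolding r_def using gA t h by blast
    have "(\<lambda>n. B (r n)) \<longlonglongrightarrow> B 0"
      by (rule tendsto_linear[OF B(2) r])
    then have "(\<lambda>n. remainder_quotient f B (g x) (t n) (A (h n) + r n) + B (r n)) \<longlonglongrightarrow> 0 + 0"
      using fB[OF t PQ[OF A h r]] linear_0[OF B(1)] by (intro tendsto_add) auto
    moreover have "remainder_quotient (\<lambda>y. f (g y)) (\<lambda>h. B (A h)) x (t n) (h n) =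
        remainder_quotient f B (g x) (t n) (A (h n) + r n) + B (r n)" for n
    proof (cases "t n = 0")
      case False
      have "g (x + t n *\<^sub>R h n) = g x + t n *\<^sub>R (A (h n) + r n)"
        unfolding r_def by (rule remainder_quotient_expand)
      with False show ?thesis
        by (simp add: remainder_quotient_def linear_add[OF B(1)] algebra_simps)
    qed (simp add: r_def linear_0[OF B(1)])
    ultimately show "(\<lambda>n. remainder_quotient (\<lambda>y. f (g y)) (\<lambda>h. B (A h)) x (t n) (h n)) \<longlonglongrightarrow> 0"
      by simp
  qed
qed

lemma bounded_differentiable_at_compose:
  assumes "bounded_differentiable_at g x" "bounded_differentiable_at f (g x)"
  shows "bounded_differentiable_at (\<lambda>y. f (g y)) x"
  using assms unfolding bounded_differentiable_at_iff
  by (rule differentiable_along_compose) (rule tvs_bounded_range_linear_plus_null)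

lemma compact_differentiable_at_compose:
  fixes g :: "'a::real_tvs \<Rightarrow> 'b::real_tvs" and f :: "'b \<Rightarrow> 'c::real_tvs"
  assumes "compact_differentiable_at g x" "compact_differentiable_at f (g x)"
  shows "compact_differentiable_at (\<lambda>y. f (g y)) x"
  using assms unfolding compact_differentiable_at_iff
proof (rule differentiable_along_compose)
  fix A :: "'a \<Rightarrow> 'b" and h :: "nat \<Rightarrow> 'a" and r :: "nat \<Rightarrow> 'b"
  assume A: "continuous_on UNIV A" and h: "convergent h" and r: "r \<longlonglongrightarrow> 0"
  obtain l where "h \<longlonglongrightarrow> l"
    using h unfolding convergent_def by blast
  from tendsto_add[OF tendsto_linear[OF A this] r] show "convergent (\<lambda>n. A (h n) + r n)"
    unfolding convergent_def by blast
qed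

lemma bounded_differentiable_at_add:
  assumes "bounded_differentiable_at f x" "bounded_differentiable_at g x"
  shows "bounded_differentiable_at (\<lambda>y. f y + g y) x"
  unfolding bounded_differentiable_at_iff
proof -
  obtain A where A: "linear A" "continuous_on UNIV A"
    "\<And>t h. t \<longlonglongrightarrow> 0 \<Longrightarrow> tvs_bounded (range h) \<Longrightarrow> (\<lambda>n. remainder_quotient f A x (t n) (h n)) \<longlonglongrightarrow> 0"
    using assms(1)[unfolded bounded_differentiable_at_iff] by (rule differentiable_alongE) blast
  obtain B where B: "linear B" "continuous_on UNIV B"
    "\<And>t h. t \<longlonglongrightarrow> 0 \<Longrightarrow> tvs_bounded (range h) \<Longrightarrow> (\<lambda>n. remainder_quotient g B x (t n) (h n)) \<longlonglongrightarrow> 0"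
    using assms(2)[unfolded bounded_differentiable_at_iff] by (rule differentiable_alongE) blast
  show "differentiable_along (\<lambda>h. tvs_bounded (range h)) (\<lambda>y. f y + g y) x"
  proof (rule differentiable_alongI)
    show "linear (\<lambda>h. A h + B h)"
      by (rule linear_compose_add[OF A(1) B(1)])
    show "continuous_on UNIV (\<lambda>h. A h + B h)"
      by (rule continuous_on_add[OF A(2) B(2)])
    fix t :: "nat \<Rightarrow> real" and h :: "nat \<Rightarrow> 'a"
    assume th: "t \<longlonglongrightarrow> 0" "tvs_bounded (range h)"
    have "remainder_quotient (\<lambda>y. f y + g y) (\<lambda>h. A h + B h) x s v = remainder_quotient f A x s v + remainder_quotient g B x s v"
      for s v
      by (simp add: remainder_quotient_def algebra_simps)
    then show "(\<lambda>n. remainder_quotient (\<lambda>y. f y + g y) (\<lambda>h. A h + B h) x (t n) (h n)) \<longlonglongrightarrow> 0"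
      using tendsto_add[OF A(3)[OF th] B(3)[OF th]] by simp
  qed
qed

lemma bounded_differentiable_at_linear:
  assumes "linear A" "continuous_on UNIV A"
  shows "bounded_differentiable_at A x"
proof -
  have "remainder_quotient A A x t h = 0" for t h
    by (simp add: remainder_quotient_def linear_add[OF assms(1)] linear_scale[OF assms(1)])
  then show ?thesis
    unfolding bounded_differentiable_at_iff
    by (intro differentiable_alongI[OF assms]) simp
qed


section \<open>Smooth real functions on a set\<close>

text \<open>The derivatives are existentially quantified instead of being chosen by an operator, so that
  closure under algebraic operations and composition follows by induction on the order \<open>n\<close>
  from the rules of differentiation.\<close>

fun ndiff_on :: "nat \<Rightarrow> real set \<Rightarrow> (real \<Rightarrow> real) \<Rightarrow> bool" where
  "ndiff_on 0 S f \<longleftrightarrow> True"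
| "ndiff_on (Suc n) S f \<longleftrightarrow>
     (\<exists>f'. (\<forall>x\<in>S. (f has_real_derivative f' x) (at x within S)) \<and> ndiff_on n S f')"

definition smooth_on :: "real set \<Rightarrow> (real \<Rightarrow> real) \<Rightarrow> bool" where
  "smooth_on S f \<longleftrightarrow> (\<forall>n. ndiff_on n S f)"

lemma ndiff_on_cong:
  assumes "\<And>x. x \<in> S \<Longrightarrow> f x = g x" "ndiff_on n S f"
  shows "ndiff_on n S g"
proof (cases n)
  case (Suc m)
  then obtain f' where f': "\<forall>x\<in>S. (f has_real_derivative f' x) (at x within S)" "ndiff_on m S f'"
    using assms(2) by auto
  have "\<forall>x\<in>S. (g has_real_derivative f' x) (at x within S)"
    using f'(1) assms(1) has_field_derivative_transform_within[OF _ zero_less_one] by metis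
  with f'(2) show ?thesis
    using Suc by auto
qed simp

lemma ndiff_on_SucD: "ndiff_on (Suc n) S f \<Longrightarrow> ndiff_on n S f"
  by (induction n arbitrary: f) (simp, metis ndiff_on.simps(2))

lemma ndiff_on_const: "ndiff_on n S (\<lambda>x. c)"
  by (induction n arbitrary: c) (auto intro!: exI[of _ "\<lambda>x. 0"])

lemma ndiff_on_ident: "ndiff_on n S (\<lambda>x. x)"
  by (cases n) (auto intro!: exI[of _ "\<lambda>x. 1"] ndiff_on_const)

lemma ndiff_on_add:
  "ndiff_on n S f \<Longrightarrow> ndiff_on n S g \<Longrightarrow> ndiff_on n S (\<lambda>x. f x + g x)"
proof (induction n arbitrary: f g)
  case (Suc n)
  then obtain f' g' where
    "\<forall>x\<in>S. (f has_real_derivative f' x) (at x within S)" "ndiff_on n S f'"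
    "\<forall>x\<in>S. (g has_real_derivative g' x) (at x within S)" "ndiff_on n S g'"
    by auto
  with Suc.IH[of f' g'] show ?case
    by (auto intro!: exI[of _ "\<lambda>x. f' x + g' x"] DERIV_add)
qed simp

lemma ndiff_on_mult:
  "ndiff_on n S f \<Longrightarrow> ndiff_on n S g \<Longrightarrow> ndiff_on n S (\<lambda>x. f x * g x)"
proof (induction n arbitrary: f g)
  case (Suc n)
  then obtain f' g' where *:
    "\<forall>x\<in>S. (f has_real_derivative f' x) (at x within S)" "ndiff_on n S f'"
    "\<forall>x\<in>S. (g has_real_derivative g' x) (at x within S)" "ndiff_on n S g'"
    by auto
  have "ndiff_on n S (\<lambda>x. f' x * g x + g' x * f x)"
    using Suc.IH[of f' g] Suc.IH[of g' f] * Suc.prems ndiff_on_add ndiff_on_SucD by blast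
  with * show ?case
    by (auto intro!: exI[of _ "\<lambda>x. f' x * g x + g' x * f x"] DERIV_mult)
qed simp

lemma ndiff_on_compose:
  "ndiff_on n UNIV f \<Longrightarrow> ndiff_on n S g \<Longrightarrow> ndiff_on n S (\<lambda>x. f (g x))"
proof (induction n arbitrary: f g)
  case (Suc n)
  then obtain f' g' where *:
    "\<forall>x. (f has_real_derivative f' x) (at x)" "ndiff_on n UNIV f'"
    "\<forall>x\<in>S. (g has_real_derivative g' x) (at x within S)" "ndiff_on n S g'"
    by auto
  have "ndiff_on n S (\<lambda>x. f' (g x) * g' x)"
    by (rule ndiff_on_mult[OF Suc.IH[OF *(2) ndiff_on_SucD[OF Suc.prems(2)]] *(4)])
  moreover have "\<forall>x\<in>S. ((\<lambda>x. f (g x)) has_real_derivative f' (g x) * g' x) (at x within S)"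
    using * DERIV_chain' by blast
  ultimately show ?case
    unfolding ndiff_on.simps by (intro exI[of _ "\<lambda>x. f' (g x) * g' x"] conjI)
qed simp

lemma ndiff_on_inverse:
  "ndiff_on n S f \<Longrightarrow> (\<And>x. x \<in> S \<Longrightarrow> f x \<noteq> 0) \<Longrightarrow> ndiff_on n S (\<lambda>x. inverse (f x))"
proof (induction n arbitrary: f)
  case (Suc n)
  then obtain f' where *:
    "\<forall>x\<in>S. (f has_real_derivative f' x) (at x within S)" "ndiff_on n S f'"
    by auto
  have "ndiff_on n S (\<lambda>x. (-1) * (inverse (f x) * f' x * inverse (f x)))"
    by (intro ndiff_on_mult ndiff_on_const Suc.IH ndiff_on_SucD[OF Suc.prems(1)] *(2) Suc.prems(2))
  moreover have "\<forall>x\<in>S. ((\<lambda>x. inverse (f x)) has_real_derivative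
      (-1) * (inverse (f x) * f' x * inverse (f x))) (at x within S)"
    using *(1) Suc.prems(2) DERIV_inverse'[of f _ _ S] by simp
  ultimately show ?case
    unfolding ndiff_on.simps by (intro exI[of _ "\<lambda>x. (-1) * (inverse (f x) * f' x * inverse (f x))"] conjI)
qed simp

lemma smooth_on_const: "smooth_on S (\<lambda>x. c)"
  and smooth_on_ident: "smooth_on S (\<lambda>x. x)"
  and smooth_on_add:
    "smooth_on S f \<Longrightarrow> smooth_on S g \<Longrightarrow> smooth_on S (\<lambda>x. f x + g x)"
  and smooth_on_mult:
    "smooth_on S f \<Longrightarrow> smooth_on S g \<Longrightarrow> smooth_on S (\<lambda>x. f x * g x)"
  and smooth_on_inverse:
    "smooth_on S f \<Longrightarrow> (\<And>x. x \<in> S \<Longrightarrow> f x \<noteq> 0) \<Longrightarrow> smooth_on S (\<lambda>x. inverse (f x))"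
  by (simp_all add: smooth_on_def ndiff_on_const ndiff_on_ident ndiff_on_add ndiff_on_mult
      ndiff_on_inverse)

lemma smooth_on_compose:
  "smooth_on UNIV f \<Longrightarrow> smooth_on S g \<Longrightarrow> smooth_on S (\<lambda>x. f (g x))"
  unfolding smooth_on_def using ndiff_on_compose by blast

lemma smooth_on_diff:
  "smooth_on S f \<Longrightarrow> smooth_on S g \<Longrightarrow> smooth_on S (\<lambda>x. f x - g x)"
  using smooth_on_add[of S f "\<lambda>x. (-1) * g x"] smooth_on_mult[OF smooth_on_const[of S "-1"]]
  by simp

lemmas smooth_intros =
  smooth_on_const smooth_on_ident smooth_on_add smooth_on_diff smooth_on_mult

text \<open>A function on the whole line has only one derivative, so the derivatives provided by the different
  orders of differentiability agree and are smooth themselves.\<close>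

lemma smooth_on_deriv:
  assumes "smooth_on UNIV f"
  shows "(f has_real_derivative deriv f x) (at x)" and "smooth_on UNIV (deriv f)"
proof -
  have *: "\<exists>f'. (\<forall>x. (f has_real_derivative f' x) (at x)) \<and> ndiff_on n UNIV f'" for n
    using assms[unfolded smooth_on_def, rule_format, of "Suc n"] by simp
  then obtain g where "\<forall>x. (f has_real_derivative g x) (at x)"
    by blast
  then show "(f has_real_derivative deriv f x) (at x)"
    using DERIV_imp_deriv[of f] by metis
  have "ndiff_on n UNIV (deriv f)" for n
  proof -
    obtain f' where "\<forall>x. (f has_real_derivative f' x) (at x)" and f': "ndiff_on n UNIV f'"
      using * by blast
    then have "deriv f = f'"
      using DERIV_imp_deriv[of f] by blast
    then show ?thesis
      using f' by simp
  qed
  then show "smooth_on UNIV (deriv f)"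
    by (simp add: smooth_on_def)
qed

text \<open>In the direction from right to left the derivatives given by \<^const>\<open>ndiff_on\<close> are identified with
  the iterated one-sided derivatives by uniqueness of derivatives on the interval.\<close>

lemma smooth01_iff_smooth_on: "smooth01 x \<longleftrightarrow> smooth_on {0..1} x"
proof
  assume x: "smooth01 x"
  have "ndiff_on n {0..1} (deriv01 j x)" for n j
  proof (induction n arbitrary: j)
    case (Suc n)
    then show ?case
      using smooth01_deriv[OF x]
      by (auto simp: has_real_derivative_iff_has_vector_derivative intro!: exI[of _ "deriv01 (Suc j) x"])
  qed simp
  from this[of _ 0] show "smooth_on {0..1} x"
    by (simp add: smooth_on_def deriv01_def)
next
  assume x: "smooth_on {0..1} x"
  have step: "y differentiable_on {0..1} \<and> smooth_on {0..1} (deriv01 1 y)"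
    if y: "smooth_on {0..1} y" for y
  proof
    have ex: "\<exists>y'. (\<forall>t\<in>{0..1}. (y has_real_derivative y' t) (at t within {0..1})) \<and>
        ndiff_on n {0..1} y'" for n
      using y[unfolded smooth_on_def, rule_format, of "Suc n"] by simp
    then show "y differentiable_on {0..1}"
      unfolding differentiable_on_def
      by (meson has_real_derivative_iff_has_vector_derivative differentiableI_vector)
    have "ndiff_on n {0..1} (deriv01 1 y)" for n
    proof -
      obtain y' where y': "\<forall>t\<in>{0..1}. (y has_real_derivative y' t) (at t within {0..1})"
        "ndiff_on n {0..1} y'"
        using ex by blast
      have "y' t = deriv01 1 y t" if "t \<in> {0..1}" for t
        using vector_derivative_within_closed_interval[of 0 1 t y "y' t"] y'(1) that
        by (simp add: deriv01_def has_real_derivative_iff_has_vector_derivative)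
      then show ?thesis
        using y'(2) ndiff_on_cong by blast
    qed
    then show "smooth_on {0..1} (deriv01 1 y)"
      by (simp add: smooth_on_def)
  qed
  have "smooth_on {0..1} (deriv01 j x)" for j
  proof (induction j)
    case 0
    then show ?case
      using x by (simp add: deriv01_def)
  next
    case (Suc j)
    then show ?case
      using step[OF Suc] by (simp add: deriv01_def)
  qed
  then show "smooth01 x"
    using step by (simp add: smooth01_def)
qed


section \<open>A smooth bounded function that is the identity near the origin\<close>

text \<open>The classical function \<open>exp (- 1 / x)\<close>, extended by \<open>0\<close>, divided by powers of \<open>x\<close>.  Up to
  linear combinations the family is closed under differentiation, which makes the smoothness of all
  members a simple induction.\<close>

definition flat :: "nat \<Rightarrow> real \<Rightarrow> real" where
  "flat m x = (if 0 < x then exp (- inverse x) * inverse x ^ m else 0)"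

text \<open>The upper bound is the term of order \<open>m + 2\<close> of the exponential series at \<open>1 / x\<close>.  The square on the
  right-hand side gives the derivative \<open>0\<close> at the origin.\<close>

lemma flat_bounds: "0 \<le> flat m x" "flat m x \<le> fact (m + 2) * x\<^sup>2"
proof -
  show "0 \<le> flat m x"
    by (simp add: flat_def)
  show "flat m x \<le> fact (m + 2) * x\<^sup>2"
  proof (cases "0 < x")
    case True
    define y where "y = inverse x"
    have y: "0 < y" "x = inverse y"
      using True by (simp_all add: y_def)
    have "y ^ (m + 2) / fact (m + 2) \<le> exp y"
      using sum_le_suminf[OF summable_exp_generic[of y], of "{m + 2}"] y
      by (auto simp: exp_def zero_le_mult_iff divide_inverse_commute)
    then have le: "y ^ m * y\<^sup>2 \<le> fact (m + 2) * exp y"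
      by (subst (asm) pos_divide_le_eq) (simp_all only: fact_gt_zero power_add mult.commute)
    have "flat m x = y ^ m * y\<^sup>2 * (exp (- y) * x\<^sup>2)"
      using y by (simp add: flat_def power_inverse)
    also have "\<dots> \<le> fact (m + 2) * exp y * (exp (- y) * x\<^sup>2)"
      by (rule mult_right_mono[OF le]) simp
    also have "\<dots> = fact (m + 2) * x\<^sup>2"
      by (simp add: exp_minus)
    finally show ?thesis .
  qed (simp add: flat_def)
qed

lemma flat_has_derivative:
  "(flat m has_real_derivative flat (m + 2) x - real m * flat (m + 1) x) (at x)"
proof -
  consider "x > 0" | "x < 0" | "x = 0"
    by linarith
  then show ?thesis
  proof cases
    case 1
    have "((\<lambda>x. exp (- inverse x) * inverse x ^ m) has_real_derivative
        exp (- inverse x) * (inverse x * inverse x) * inverse x ^ m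
        - exp (- inverse x) * (real m * inverse x ^ (m - 1) * (inverse x * inverse x))) (at x)"
      using 1 by (auto intro!: derivative_eq_intros)
    also have "exp (- inverse x) * (inverse x * inverse x) * inverse x ^ m
        - exp (- inverse x) * (real m * inverse x ^ (m - 1) * (inverse x * inverse x))
        = flat (m + 2) x - real m * flat (m + 1) x"
      using 1 by (cases m) (simp_all add: flat_def)
    finally have "((\<lambda>x. exp (- inverse x) * inverse x ^ m) has_real_derivative
        flat (m + 2) x - real m * flat (m + 1) x) (at x)" .
    then show ?thesis
      by (rule has_field_derivative_transform_within_open[of _ _ _ "{0<..}"])
         (use 1 in \<open>auto simp: flat_def\<close>)
  next
    case 2
    have "((\<lambda>x. 0) has_real_derivative flat (m + 2) x - real m * flat (m + 1) x) (at x)"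
      using 2 by (simp add: flat_def)
    then show ?thesis
      by (rule has_field_derivative_transform_within_open[of _ _ _ "{..<0}"])
         (use 2 in \<open>auto simp: flat_def\<close>)
  next
    case 3
    have "((\<lambda>h. flat m h / h) \<longlongrightarrow> 0) (at 0)"
    proof (rule Lim_null_comparison)
      have "norm (flat m h / h) \<le> fact (m + 2) * \<bar>h\<bar>" for h
        using flat_bounds[of m h]
        by (cases "h = 0") (auto simp: divide_simps abs_mult power2_eq_square)
      then show "\<forall>\<^sub>F h in at 0. norm (flat m h / h) \<le> fact (m + 2) * \<bar>h\<bar>"
        by simp
      show "((\<lambda>h::real. fact (m + 2) * \<bar>h\<bar>) \<longlongrightarrow> 0) (at 0)"
        by (auto intro!: tendsto_eq_intros)
    qed
    then show ?thesis
      unfolding 3 has_field_derivative_iff by (simp add: flat_def)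
  qed
qed

lemma smooth_flat: "smooth_on UNIV (flat m)"
proof -
  have "ndiff_on n UNIV (flat m)" for n
  proof (induction n arbitrary: m)
    case (Suc n)
    have "ndiff_on n UNIV (\<lambda>x. flat (m + 2) x + (- real m) * flat (m + 1) x)"
      by (intro ndiff_on_add ndiff_on_mult ndiff_on_const Suc)
    then show ?case
      using flat_has_derivative[of m]
      by (auto intro!: exI[of _ "\<lambda>x. flat (m + 2) x + (- real m) * flat (m + 1) x"])
  qed simp
  then show ?thesis
    by (simp add: smooth_on_def)
qed

text \<open>Multiply \<open>s\<close> by a smooth bump function \<open>\<phi>\<close> that is \<open>1\<close> on \<open>[-1, 1]\<close> and \<open>0\<close> outside \<open>[-2, 2]\<close>, and
  rescale.\<close>

lemma exists_smooth_cutoff: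
  assumes "0 < c"
  obtains h where "smooth_on UNIV h" "\<And>s. \<bar>h s\<bar> \<le> c" "\<And>s. \<bar>s\<bar> \<le> c / 2 \<Longrightarrow> h s = s"
proof -
  define \<phi> where "\<phi> s = flat 0 (4 - s * s) * inverse (flat 0 (4 - s * s) + flat 0 (s * s - 1))" for s
  define h where "h s = c / 2 * (2 / c * s * \<phi> (2 / c * s))" for s
  have pos: "flat 0 (4 - s * s) + flat 0 (s * s - 1) > 0" for s
    by (auto simp: flat_def add_pos_pos)
  have "smooth_on UNIV (\<lambda>s. flat 0 (4 - s * s))" "smooth_on UNIV (\<lambda>s. flat 0 (s * s - 1))"
    by (rule smooth_on_compose[OF smooth_flat]; intro smooth_intros)+
  then have \<phi>: "smooth_on UNIV \<phi>"
    unfolding \<phi>_def using pos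
    by (intro smooth_on_mult smooth_on_inverse smooth_on_add) (auto simp: less_imp_neq[symmetric])
  have "smooth_on UNIV (\<lambda>s. \<phi> (2 / c * s))"
    by (rule smooth_on_compose[OF \<phi>]) (intro smooth_intros)
  then have "smooth_on UNIV h"
    unfolding h_def by (intro smooth_on_mult smooth_on_const smooth_on_ident)
  moreover have "\<bar>s * \<phi> s\<bar> \<le> 2" for s
  proof (cases "\<bar>s\<bar> < 2")
    case True
    have "0 \<le> \<phi> s" "\<phi> s \<le> 1"
      using pos[of s] flat_bounds(1)[of 0 "4 - s * s"] flat_bounds(1)[of 0 "s * s - 1"]
      by (auto simp: \<phi>_def divide_simps)
    then have "\<bar>s * \<phi> s\<bar> \<le> 2 * 1"
      unfolding abs_mult using True by (intro mult_mono) auto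
    then show ?thesis
      by simp
  next
    case False
    then have "4 - s * s \<le> 0"
      using abs_le_square_iff[of 2 s] by (simp add: power2_eq_square)
    then show ?thesis
      by (simp add: \<phi>_def flat_def)
  qed
  then have "\<bar>h s\<bar> \<le> c" for s
    using assms mult_left_mono[of "\<bar>2 / c * s * \<phi> (2 / c * s)\<bar>" 2 "c / 2"]
    unfolding h_def abs_mult[of "c / 2"] by (simp only:) simp
  moreover have "h s = s" if "\<bar>s\<bar> \<le> c / 2" for s
  proof -
    define r where "r = 2 / c * s"
    have "\<bar>r\<bar> \<le> 1"
      using that assms by (simp add: r_def abs_mult field_simps)
    then have "r * r - 1 \<le> 0"
      using abs_le_square_iff[of r 1] by (simp add: power2_eq_square)
    then have "\<phi> r = 1"
      using pos[of r] by (simp add: \<phi>_def flat_def)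
    then show ?thesis
      using assms by (simp add: h_def r_def)
  qed
  ultimately show ?thesis
    using that by blast
qed


section \<open>The algebra of smooth functions on the unit interval\<close>

lemma smooth_on_fun01: "smooth_on {0..1} (fun01 x)"
  using smooth01_fun01 smooth01_iff_smooth_on by blast

lemma smooth_fun01_eqI:
  assumes "\<And>t. t \<in> {0..1} \<Longrightarrow> fun01 x t = fun01 y t"
  shows "x = y"
proof -
  have "fun01 x t = fun01 y t" for t
    using assms[of t] fun01[of x] fun01[of y] by (cases "t \<in> {0..1}") auto
  then show ?thesis
    by (simp add: fun01_inject[symmetric] fun_eq_iff)
qed

text \<open>The value is unspecified unless \<open>f\<close> is smooth on the unit interval.\<close>

definition restrict01 :: "(real \<Rightarrow> real) \<Rightarrow> smooth_fun01" where
  "restrict01 f = Abs_smooth_fun01 (\<lambda>t. if t \<in> {0..1} then f t else 0)"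

lemma fun01_restrict01:
  assumes "smooth_on {0..1} f" "t \<in> {0..1}"
  shows "fun01 (restrict01 f) t = f t"
proof -
  have "smooth_on {0..1} (\<lambda>t. if t \<in> {0..1} then f t else 0)"
    using assms(1) ndiff_on_cong[of "{0..1}" f "\<lambda>t. if t \<in> {0..1} then f t else 0"]
    by (simp add: smooth_on_def)
  then show ?thesis
    unfolding restrict01_def
    by (subst Abs_smooth_fun01_inverse) (use assms(2) in \<open>auto simp: smooth01_iff_smooth_on\<close>)
qed

instantiation smooth_fun01 :: real_algebra
begin

lift_definition times_smooth_fun01 :: "smooth_fun01 \<Rightarrow> smooth_fun01 \<Rightarrow> smooth_fun01"
  is "\<lambda>x y t. x t * y t"
  by (simp add: smooth01_iff_smooth_on smooth_on_mult)

instance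
  by standard (transfer; simp add: algebra_simps)+

end

instance smooth_fun01 :: comm_ring
  by standard (transfer; simp add: algebra_simps)+

lemmas fun01_simps =
  plus_smooth_fun01.rep_eq minus_smooth_fun01.rep_eq times_smooth_fun01.rep_eq
  scaleR_smooth_fun01.rep_eq

definition deriv_op :: "smooth_fun01 \<Rightarrow> smooth_fun01" where
  "deriv_op x = restrict01 (deriv01 1 (fun01 x))"

lemma fun01_deriv_op:
  assumes "t \<in> {0..1}"
  shows "fun01 (deriv_op x) t = deriv01 1 (fun01 x) t"
proof -
  have "smooth01 (deriv01 1 (fun01 x))"
    by (rule smooth01_characterization(1)[where D = "\<lambda>j. deriv01 (Suc j) (fun01 x)"])
       (simp_all add: smooth01_deriv smooth01_fun01)
  then show ?thesis
    unfolding deriv_op_def using assms by (simp add: fun01_restrict01 smooth01_iff_smooth_on)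
qed

lemma deriv01_Suc_fun01:
  assumes "t \<in> {0..1}"
  shows "deriv01 (Suc j) (fun01 x) t = deriv01 j (fun01 (deriv_op x)) t"
  by (rule smooth01_characterization(2)[where D = "\<lambda>j. deriv01 (Suc j) (fun01 x)", symmetric])
     (use assms in \<open>simp_all add: smooth01_deriv smooth01_fun01 fun01_deriv_op\<close>)

lemma has_derivative_fun01:
  assumes "t \<in> {0..1}"
  shows "(fun01 x has_real_derivative fun01 (deriv_op x) t) (at t within {0..1})"
  using smooth01_deriv[OF smooth01_fun01 assms, of 0 x] fun01_deriv_op[OF assms, of x]
  by (simp add: has_real_derivative_iff_has_vector_derivative deriv01_def)

lemma deriv_op_eqI:
  assumes "\<And>t. t \<in> {0..1} \<Longrightarrow> (fun01 x has_real_derivative fun01 y t) (at t within {0..1})"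
  shows "deriv_op x = y"
proof (rule smooth_fun01_eqI)
  fix t :: real
  assume t: "t \<in> {0..1}"
  show "fun01 (deriv_op x) t = fun01 y t"
    using vector_derivative_within_closed_interval[of 0 1 t "fun01 x"] t
      has_derivative_fun01[OF t, of x] assms[OF t]
    by (metis has_real_derivative_iff_has_vector_derivative zero_less_one)
qed

lemma linear_deriv_op: "linear deriv_op"
proof (rule linearI)
  show "deriv_op (x + y) = deriv_op x + deriv_op y" for x y
    by (rule deriv_op_eqI)
       (auto simp: plus_smooth_fun01.rep_eq intro!: DERIV_add has_derivative_fun01)
  show "deriv_op (c *\<^sub>R x) = c *\<^sub>R deriv_op x" for c x
    by (rule deriv_op_eqI)
       (auto simp: scaleR_smooth_fun01.rep_eq intro!: DERIV_cmult has_derivative_fun01)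
qed

lemma deriv_op_mult: "deriv_op (x * y) = deriv_op x * y + deriv_op y * x"
  by (rule deriv_op_eqI)
     (auto simp: plus_smooth_fun01.rep_eq times_smooth_fun01.rep_eq
       intro!: DERIV_mult has_derivative_fun01)

lemma cnorm_0_le_iff: "cnorm 0 x \<le> c \<longleftrightarrow> (\<forall>t\<in>{0..1}. \<bar>fun01 x t\<bar> \<le> c)"
  by (simp add: cnorm_le_iff deriv01_def)

text \<open>This recursion lets estimates of the norms be proved by induction on \<open>k\<close>, without formulas for
  higher derivatives of products and compositions.\<close>

lemma cnorm_Suc_le_iff: "cnorm (Suc k) x \<le> c \<longleftrightarrow> cnorm 0 x \<le> c \<and> cnorm k (deriv_op x) \<le> c"
proof -
  have "(\<forall>j\<le>Suc k. P j) \<longleftrightarrow> P 0 \<and> (\<forall>j\<le>k. P (Suc j))" for P :: "nat \<Rightarrow> bool"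
    by (metis Suc_le_mono not0_implies_Suc le0)
  then show ?thesis
    by (simp add: cnorm_le_iff deriv01_Suc_fun01)
qed

lemma abs_fun01_le_cnorm: "t \<in> {0..1} \<Longrightarrow> \<bar>fun01 x t\<bar> \<le> cnorm k x"
  using deriv01_le_cnorm[of 0 k t x] by (simp add: deriv01_def)

lemma cnorm_deriv_op_le: "cnorm k (deriv_op x) \<le> cnorm (Suc k) x"
  using cnorm_Suc_le_iff by blast

lemma cnorm_Suc_le_add: "cnorm (Suc k) x \<le> cnorm 0 x + cnorm k (deriv_op x)"
  unfolding cnorm_Suc_le_iff by (simp add: cnorm_nonneg)

text \<open>The constant doubles with each order, since the product rule has two terms.\<close>

lemma cnorm_mult_le: "cnorm k (x * y) \<le> 2 ^ k * (cnorm k x * cnorm k y)"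
proof (induction k arbitrary: x y)
  case 0
  show ?case
    by (auto simp: cnorm_0_le_iff times_smooth_fun01.rep_eq abs_mult cnorm_nonneg
        intro!: mult_mono abs_fun01_le_cnorm)
next
  case (Suc k)
  let ?p = "cnorm (Suc k) x * cnorm (Suc k) y"
  have p: "0 \<le> ?p"
    by (simp add: cnorm_nonneg)
  have half: "cnorm k (deriv_op x * y) \<le> 2 ^ k * (cnorm (Suc k) x * cnorm (Suc k) y)" for x y
    by (rule order_trans[OF Suc.IH])
       (intro mult_left_mono mult_mono cnorm_deriv_op_le cnorm_mono; simp add: cnorm_nonneg)
  have "cnorm k (deriv_op (x * y)) \<le> 2 ^ Suc k * ?p"
    using cnorm_triangle[of k "deriv_op x * y" "deriv_op y * x"] half[of x y] half[of y x]
    by (simp add: deriv_op_mult mult.commute)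
  moreover have "cnorm 0 (x * y) \<le> 1 * ?p"
    by (auto simp: cnorm_0_le_iff times_smooth_fun01.rep_eq abs_mult cnorm_nonneg
        intro!: mult_mono abs_fun01_le_cnorm)
  then have "cnorm 0 (x * y) \<le> 2 ^ Suc k * ?p"
    using mult_right_mono[OF one_le_power[of "2::real" "Suc k"] p] by simp
  ultimately show ?case
    by (simp add: cnorm_Suc_le_iff)
qed

lemma continuous_on_linear_smooth_fun01:
  assumes A: "linear A" and bound: "\<And>k. \<exists>l C. \<forall>x. cnorm k (A x) \<le> C * cnorm l x"
  shows "continuous_on UNIV A"
  unfolding continuous_on_def
proof
  fix x
  show "(A \<longlongrightarrow> A x) (at x within UNIV)"
    unfolding tendsto_smooth_fun01_iff
  proof
    fix k
    obtain l C where C: "\<And>x. cnorm k (A x) \<le> C * cnorm l x"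
      using bound by blast
    have "((\<lambda>y. y) \<longlongrightarrow> x) (at x)"
      by (rule tendsto_ident_at)
    then have "((\<lambda>y. C * cnorm l (y - x)) \<longlongrightarrow> 0) (at x)"
      by (intro tendsto_mult_right_zero) (simp add: tendsto_smooth_fun01_iff)
    then show "((\<lambda>y. cnorm k (A y - A x)) \<longlongrightarrow> 0) (at x within UNIV)"
      by (rule Lim_null_comparison[rotated])
         (use C in \<open>simp add: linear_diff[OF A, symmetric] cnorm_nonneg\<close>)
  qed
qed

lemma tvs_bounded_cnorm:
  assumes "tvs_bounded S"
  shows "\<exists>M. \<forall>v\<in>S. cnorm k v \<le> M"
proof -
  have "open {y. cnorm k (y - 0) < 1}" "0 \<in> {y. cnorm k (y - 0) < 1}"
    by (rule open_cnorm_ball) simp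
  then obtain s where s: "s > 0" "\<And>t. t > s \<Longrightarrow> S \<subseteq> (\<lambda>v. t *\<^sub>R v) ` {y. cnorm k (y - 0) < 1}"
    using assms unfolding tvs_bounded_def by blast
  have "cnorm k v \<le> s + 1" if "v \<in> S" for v
  proof -
    have "v \<in> (\<lambda>v. (s + 1) *\<^sub>R v) ` {y. cnorm k (y - 0) < 1}"
      using s(2)[of "s + 1"] that by fastforce
    then obtain y where y: "v = (s + 1) *\<^sub>R y" "cnorm k y < 1"
      by auto
    have "cnorm k v \<le> (s + 1) * cnorm k y"
      using cnorm_scaleR_le[of k "s + 1" y] s(1) y(1) by simp
    also have "\<dots> \<le> (s + 1) * 1"
      using s(1) y(2) by (intro mult_left_mono) auto
    finally show ?thesis by simp
  qed
  then show ?thesis by blast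
qed


section \<open>Superposition operators\<close>

text \<open>The superposition (Nemytskii) operator of \<open>h\<close>.\<close>

definition superpose :: "(real \<Rightarrow> real) \<Rightarrow> smooth_fun01 \<Rightarrow> smooth_fun01" where
  "superpose h x = restrict01 (\<lambda>t. h (fun01 x t))"

lemma fun01_superpose:
  "smooth_on UNIV h \<Longrightarrow> t \<in> {0..1} \<Longrightarrow> fun01 (superpose h x) t = h (fun01 x t)"
  unfolding superpose_def by (rule fun01_restrict01[OF smooth_on_compose[OF _ smooth_on_fun01]])

lemma deriv_op_superpose:
  assumes h: "smooth_on UNIV h"
  shows "deriv_op (superpose h x) = superpose (deriv h) x * deriv_op x"
proof (rule deriv_op_eqI)
  fix t :: real
  assume t: "t \<in> {0..1}"
  have "((\<lambda>s. h (fun01 x s)) has_real_derivative deriv h (fun01 x t) * fun01 (deriv_op x) t)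
      (at t within {0..1})"
    by (rule DERIV_chain'[OF has_derivative_fun01[OF t] smooth_on_deriv(1)[OF h]])
  then have "(fun01 (superpose h x) has_real_derivative deriv h (fun01 x t) * fun01 (deriv_op x) t)
      (at t within {0..1})"
    by (rule has_field_derivative_transform_within[OF _ zero_less_one t])
       (simp add: fun01_superpose h)
  then show "(fun01 (superpose h x) has_real_derivative
      fun01 (superpose (deriv h) x * deriv_op x) t) (at t within {0..1})"
    by (simp add: times_smooth_fun01.rep_eq fun01_superpose[OF smooth_on_deriv(2)[OF h] t])
qed

text \<open>The constant is a bound of the second derivative on \<open>[- M - 1, M + 1]\<close>, which contains all points
  between \<open>a\<close> and \<open>a + b\<close>.\<close>

lemma smooth_quadratic_remainder:
  assumes h: "smooth_on UNIV h"
  obtains K where "0 \<le> K"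
    "\<And>a b. \<bar>a\<bar> \<le> M \<Longrightarrow> \<bar>b\<bar> \<le> 1 \<Longrightarrow> \<bar>h (a + b) - h a - deriv h a * b\<bar> \<le> K * b\<^sup>2"
proof -
  note h' = smooth_on_deriv(2)[OF h]
  note h'' = smooth_on_deriv(2)[OF h']
  have "continuous_on {- M - 1..M + 1} (deriv (deriv h))"
    using smooth_on_deriv(1)[OF h''] by (meson DERIV_isCont continuous_at_imp_continuous_on)
  then have "bounded (deriv (deriv h) ` {- M - 1..M + 1})"
    by (intro compact_imp_bounded compact_continuous_image) auto
  then obtain K where K: "K > 0" "\<And>z. z \<in> {- M - 1..M + 1} \<Longrightarrow> \<bar>deriv (deriv h) z\<bar> \<le> K"
    unfolding bounded_pos by auto
  have "\<bar>h (a + b) - h a - deriv h a * b\<bar> \<le> K * b\<^sup>2" if ab: "\<bar>a\<bar> \<le> M" "\<bar>b\<bar> \<le> 1" for a b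
  proof (cases "b = 0")
    case False
    define D where "D m = (deriv ^^ m) h" for m
    have D: "(D m has_real_derivative D (Suc m) z) (at z)" for m z
    proof -
      have "smooth_on UNIV (D m)"
        by (induction m) (simp_all add: D_def h smooth_on_deriv(2))
      from smooth_on_deriv(1)[OF this] show ?thesis
        by (simp add: D_def)
    qed
    have "-1 \<le> b" "b \<le> 1"
      using ab(2) by auto
    then have "\<exists>z. (if a + b < a then a + b < z \<and> z < a else a < z \<and> z < a + b) \<and>
        h (a + b) = (\<Sum>m<2. D m a / fact m * (a + b - a) ^ m) + D 2 z / fact 2 * (a + b - a)\<^sup>2"
      using D False by (intro Taylor[of 2 D h "a - 1" "a + 1"]) (auto simp: D_def)
    then obtain z where z: "if a + b < a then a + b < z \<and> z < a else a < z \<and> z < a + b"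
      and eq: "h (a + b) = (\<Sum>m<2. D m a / fact m * (a + b - a) ^ m) + D 2 z / fact 2 * (a + b - a)\<^sup>2"
      by blast
    have "z \<in> {- M - 1..M + 1}"
      using z ab by (auto split: if_splits)
    then have "\<bar>D 2 z / 2\<bar> \<le> K"
      using K(1) K(2)[of z] by (simp add: D_def numeral_2_eq_2)
    then have "\<bar>D 2 z / 2\<bar> * b\<^sup>2 \<le> K * b\<^sup>2"
      by (rule mult_right_mono) simp
    moreover have "h (a + b) - h a - deriv h a * b = D 2 z / 2 * b\<^sup>2"
      using eq by (simp add: D_def numeral_2_eq_2)
    ultimately show ?thesis
      by (simp only: abs_mult abs_power2)
  qed simp
  then show ?thesis
    using that[of K] K(1) by auto
qed

text \<open>The derivative of a superposition operator at \<open>u\<close> is multiplication by \<open>h' \<circ> u\<close>.\<close>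

abbreviation superpose_remainder :: "(real \<Rightarrow> real) \<Rightarrow> smooth_fun01 \<Rightarrow> real \<Rightarrow> smooth_fun01 \<Rightarrow> smooth_fun01"
  where "superpose_remainder h u \<equiv> remainder_quotient (superpose h) (\<lambda>v. superpose (deriv h) u * v) u"

text \<open>The derivative of the remainder quotient for \<open>h\<close> is expressed by the remainder quotient for \<open>h'\<close>.
  This reduces convergence in the norm of order \<open>k + 1\<close> to convergence in the norm of order \<open>k\<close>
  for another smooth function.\<close>

lemma deriv_op_superpose_remainder:
  assumes h: "smooth_on UNIV h"
  shows "deriv_op (superpose_remainder h u t v) =
    superpose_remainder (deriv h) u t v * deriv_op u +
    t *\<^sub>R ((superpose_remainder (deriv h) u t v + superpose (deriv (deriv h)) u * v) * deriv_op v)"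
proof (cases "t = 0")
  case False
  let ?P = "superpose (deriv h) u" and ?Q = "superpose (deriv (deriv h)) u"
  let ?R = "superpose_remainder (deriv h) u t v"
  note lin = linear_add[OF linear_deriv_op] linear_diff[OF linear_deriv_op]
    linear_scale[OF linear_deriv_op]
  have P: "superpose (deriv h) (u + t *\<^sub>R v) = ?P + t *\<^sub>R (?Q * v + ?R)"
    by (rule remainder_quotient_expand)
  \<comment> \<open>Stated for arbitrary factors: ring normalization would otherwise rewrite the multiplication
    operator inside the remainder quotient.\<close>
  have product: "(p + t *\<^sub>R (q * v + r)) * (a + t *\<^sub>R b) - p * a - t *\<^sub>R (q * a * v + b * p) =
      t *\<^sub>R (r * a + t *\<^sub>R ((r + q * v) * b))" for p q r a b :: smooth_fun01
    by (simp add: algebra_simps)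
  have "t *\<^sub>R deriv_op (superpose_remainder h u t v) =
      superpose (deriv h) (u + t *\<^sub>R v) * (deriv_op u + t *\<^sub>R deriv_op v) - ?P * deriv_op u
      - t *\<^sub>R (?Q * deriv_op u * v + deriv_op v * ?P)"
    using False
    by (simp add: remainder_quotient_def[of "superpose h"] lin deriv_op_superpose h deriv_op_mult smooth_on_deriv(2))
  also have "\<dots> = t *\<^sub>R (?R * deriv_op u + t *\<^sub>R ((?R + ?Q * v) * deriv_op v))"
    unfolding P by (rule product)
  finally show ?thesis
    using False by simp
qed (simp add: linear_0[OF linear_deriv_op])

text \<open>By induction on \<open>k\<close>, for all smooth \<open>h\<close> at once.  At order \<open>0\<close> the remainder is
  quadratic in \<open>t n\<close>, uniformly on the interval; the step is the preceding identity together with the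
  estimate for products.\<close>

lemma superpose_remainder_tendsto_0:
  assumes "smooth_on UNIV h" and t: "t \<longlonglongrightarrow> 0" and v: "\<And>k. \<exists>M. \<forall>n. cnorm k (v n) \<le> M"
  shows "(\<lambda>n. cnorm k (superpose_remainder h u (t n) (v n))) \<longlonglongrightarrow> 0"
  using assms(1)
proof (induction k arbitrary: h)
  case (0 h)
  obtain M where M: "\<And>n. cnorm 0 (v n) \<le> M"
    using v by blast
  obtain K where K: "0 \<le> K" "\<And>a b. \<bar>a\<bar> \<le> cnorm 0 u \<Longrightarrow> \<bar>b\<bar> \<le> 1 \<Longrightarrow>
      \<bar>h (a + b) - h a - deriv h a * b\<bar> \<le> K * b\<^sup>2"
    using smooth_quadratic_remainder[OF 0, of "cnorm 0 u"] by blast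
  have "\<forall>\<^sub>F n in sequentially. \<bar>t n\<bar> * M < 1"
    using order_tendstoD(2)[OF tendsto_mult_left_zero[OF tendsto_rabs_zero[OF t]], of 1 M] by simp
  then have "\<forall>\<^sub>F n in sequentially. norm (cnorm 0 (superpose_remainder h u (t n) (v n))) \<le> \<bar>t n\<bar> * (K * M\<^sup>2)"
  proof eventually_elim
    case (elim n)
    have "\<bar>fun01 (superpose_remainder h u (t n) (v n)) s\<bar> \<le> \<bar>t n\<bar> * (K * M\<^sup>2)" if s: "s \<in> {0..1}" for s
    proof (cases "t n = 0")
      case False
      let ?a = "fun01 u s" and ?w = "fun01 (v n) s"
      have w: "\<bar>?w\<bar> \<le> M"
        using abs_fun01_le_cnorm[OF s] M order_trans by blast
      have "\<bar>t n * ?w\<bar> \<le> \<bar>t n\<bar> * M"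
        unfolding abs_mult using w by (intro mult_left_mono) auto
      then have "\<bar>h (?a + t n * ?w) - h ?a - deriv h ?a * (t n * ?w)\<bar> \<le> K * (t n * ?w)\<^sup>2"
        using elim by (intro K(2) abs_fun01_le_cnorm s) simp
      also have "\<dots> = \<bar>t n\<bar> * (\<bar>t n\<bar> * (K * \<bar>?w\<bar>\<^sup>2))"
        by (simp add: power2_eq_square)
      also have "\<dots> \<le> \<bar>t n\<bar> * (\<bar>t n\<bar> * (K * M\<^sup>2))"
        using w K(1) by (intro mult_left_mono power_mono) auto
      finally have "\<bar>h (?a + t n * ?w) - h ?a - deriv h ?a * (t n * ?w)\<bar> / \<bar>t n\<bar>
          \<le> \<bar>t n\<bar> * (K * M\<^sup>2)"
        using False by (simp add: pos_divide_le_eq mult.commute)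
      moreover have "fun01 (superpose_remainder h u (t n) (v n)) s =
          (h (?a + t n * ?w) - h ?a - deriv h ?a * (t n * ?w)) / t n"
        using s 0 by (simp add: remainder_quotient_def fun01_simps fun01_superpose smooth_on_deriv(2)
            divide_inverse_commute mult_ac)
      ultimately show ?thesis
        by (simp add: abs_divide)
    qed (simp add: zero_smooth_fun01.rep_eq)
    then show ?case
      by (simp add: cnorm_nonneg cnorm_0_le_iff)
  qed
  then show ?case
    by (rule Lim_null_comparison) (use tendsto_mult_left_zero[OF tendsto_rabs_zero[OF t]] in simp)
next
  case (Suc k h)
  note h' = smooth_on_deriv(2)[OF Suc.prems]
  obtain M where M: "\<And>n. cnorm k (v n) \<le> M"
    using v by blast
  obtain M' where "\<And>n. cnorm (Suc k) (v n) \<le> M'"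
    using v by blast
  then have M': "cnorm k (deriv_op (v n)) \<le> M'" for n
    using cnorm_deriv_op_le order_trans by blast
  have M0: "0 \<le> M" "0 \<le> M'"
    using M M' cnorm_nonneg order_trans by blast+
  define Q where "Q = superpose (deriv (deriv h)) u"
  define R where "R n = remainder_quotient (superpose (deriv h)) ((*) Q) u (t n) (v n)" for n
  define bnd where "bnd n = cnorm k (superpose_remainder h u (t n) (v n)) +
      (2 ^ k * (cnorm k (R n) * cnorm k (deriv_op u)) +
       \<bar>t n\<bar> * (2 ^ k * ((cnorm k (R n) + 2 ^ k * (cnorm k Q * M)) * M')))" for n
  have le: "\<forall>n. norm (cnorm (Suc k) (superpose_remainder h u (t n) (v n))) \<le> bnd n"
  proof
    fix n
    have "cnorm k (R n + Q * v n) \<le> cnorm k (R n) + 2 ^ k * (cnorm k Q * M)"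
      by (intro order_trans[OF cnorm_triangle] add_left_mono order_trans[OF cnorm_mult_le]
          mult_left_mono M) (simp_all add: cnorm_nonneg)
    then have "cnorm k ((R n + Q * v n) * deriv_op (v n)) \<le>
        2 ^ k * ((cnorm k (R n) + 2 ^ k * (cnorm k Q * M)) * M')"
      by (intro order_trans[OF cnorm_mult_le] mult_left_mono mult_mono M')
         (simp_all add: cnorm_nonneg M0)
    then have "cnorm k (t n *\<^sub>R ((R n + Q * v n) * deriv_op (v n))) \<le>
        \<bar>t n\<bar> * (2 ^ k * ((cnorm k (R n) + 2 ^ k * (cnorm k Q * M)) * M'))"
      by (intro order_trans[OF cnorm_scaleR_le] mult_left_mono) simp_all
    then have "cnorm k (deriv_op (superpose_remainder h u (t n) (v n))) \<le>
        2 ^ k * (cnorm k (R n) * cnorm k (deriv_op u)) +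
        \<bar>t n\<bar> * (2 ^ k * ((cnorm k (R n) + 2 ^ k * (cnorm k Q * M)) * M'))"
      unfolding deriv_op_superpose_remainder[OF Suc.prems] Q_def[symmetric] R_def[symmetric]
      by (intro order_trans[OF cnorm_triangle] add_mono cnorm_mult_le)
    then show "norm (cnorm (Suc k) (superpose_remainder h u (t n) (v n))) \<le> bnd n"
      using cnorm_Suc_le_add[of k "superpose_remainder h u (t n) (v n)"]
        cnorm_mono[of 0 k "superpose_remainder h u (t n) (v n)"]
      by (simp add: bnd_def cnorm_nonneg)
  qed
  \<comment> \<open>The order \<open>0\<close> remainder of \<open>h\<close> itself is dominated by that of order \<open>k\<close>, to which the induction
    hypothesis applies again.\<close>
  have lim: "bnd \<longlonglongrightarrow> 0"
  proof -
    have R: "(\<lambda>n. cnorm k (R n)) \<longlonglongrightarrow> 0"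
      unfolding R_def Q_def by (rule Suc.IH[OF h'])
    have "bnd \<longlonglongrightarrow> 0 + (2 ^ k * (0 * cnorm k (deriv_op u)) +
        \<bar>0\<bar> * (2 ^ k * ((0 + 2 ^ k * (cnorm k Q * M)) * M')))"
      unfolding bnd_def
      by (intro tendsto_add tendsto_mult tendsto_const tendsto_rabs R Suc.IH[OF Suc.prems] t)
    then show ?thesis
      by simp
  qed
  show ?case
    by (rule Lim_null_comparison[OF always_eventually[OF le] lim])
qed

lemma bounded_differentiable_superpose:
  assumes "smooth_on UNIV h"
  shows "bounded_differentiable_at (superpose h) u"
  unfolding bounded_differentiable_at_iff
proof (rule differentiable_alongI)
  show lin: "linear (\<lambda>v. superpose (deriv h) u * v)"
    by (rule linearI) (simp_all add: algebra_simps)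
  show "continuous_on UNIV (\<lambda>v. superpose (deriv h) u * v)"
  proof (rule continuous_on_linear_smooth_fun01[OF lin])
    fix k
    have "cnorm k (superpose (deriv h) u * v) \<le> 2 ^ k * cnorm k (superpose (deriv h) u) * cnorm k v" for v
      using cnorm_mult_le by (simp add: mult.assoc)
    then show "\<exists>l C. \<forall>v. cnorm k (superpose (deriv h) u * v) \<le> C * cnorm l v"
      by blast
  qed
  fix t :: "nat \<Rightarrow> real" and v :: "nat \<Rightarrow> smooth_fun01"
  assume t: "t \<longlonglongrightarrow> 0" and "tvs_bounded (range v)"
  then have "\<exists>M. \<forall>n. cnorm k (v n) \<le> M" for k
    using tvs_bounded_cnorm[of "range v" k] by blast
  then show "(\<lambda>n. superpose_remainder h u (t n) (v n)) \<longlonglongrightarrow> 0"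
    using superpose_remainder_tendsto_0[OF assms t] by (simp add: tendsto_smooth_fun01_iff)
qed


section \<open>Localization near the origin\<close>

lemma smooth_fun01_eqI_deriv_op:
  assumes "deriv_op x = deriv_op y" "fun01 x 0 = fun01 y 0"
  shows "x = y"
proof (rule smooth_fun01_eqI)
  fix t :: real
  assume t: "t \<in> {0..1}"
  have "((\<lambda>s. fun01 x s - fun01 y s) has_real_derivative 0) (at s within {0..1})"
    if "s \<in> {0..1}" for s
    using DERIV_diff[OF has_derivative_fun01[OF that, of x] has_derivative_fun01[OF that, of y]]
      assms(1) by simp
  then obtain c where "\<And>s. s \<in> {0..1} \<Longrightarrow> fun01 x s - fun01 y s = c"
    using has_field_derivative_zero_constant[OF convex_real_interval(5)] by metis
  from this[OF t] this[of 0] show "fun01 x t = fun01 y t"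
    using assms(2) by simp
qed

text \<open>The operators \<open>const_op\<close> and \<open>integral_op\<close> recover a function from its value at \<open>0\<close> and its
  derivative.\<close>

definition const_op :: "smooth_fun01 \<Rightarrow> smooth_fun01" where
  "const_op x = restrict01 (\<lambda>t. fun01 x 0)"

definition integral_op :: "smooth_fun01 \<Rightarrow> smooth_fun01" where
  "integral_op x = restrict01 (\<lambda>t. integral {0..t} (fun01 x))"

lemma fun01_const_op: "t \<in> {0..1} \<Longrightarrow> fun01 (const_op x) t = fun01 x 0"
  unfolding const_op_def by (simp add: fun01_restrict01 smooth_on_const)

lemma deriv_op_const_op: "deriv_op (const_op x) = 0"
proof (rule deriv_op_eqI)
  fix t :: real
  assume t: "t \<in> {0..1}"
  show "(fun01 (const_op x) has_real_derivative fun01 0 t) (at t within {0..1})"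
    by (rule has_field_derivative_transform_within[OF _ zero_less_one t, of "\<lambda>s. fun01 x 0"])
       (simp_all add: fun01_const_op zero_smooth_fun01.rep_eq)
qed

lemma continuous_on_fun01: "continuous_on {0..1} (fun01 x)"
  using has_derivative_fun01 DERIV_continuous_on by blast

lemma fun01_integral_op:
  assumes "t \<in> {0..1}"
  shows "fun01 (integral_op x) t = integral {0..t} (fun01 x)"
proof -
  have "ndiff_on n {0..1} (\<lambda>t. integral {0..t} (fun01 x))" for n
  proof (cases n)
    case (Suc m)
    have "((\<lambda>t. integral {0..t} (fun01 x)) has_real_derivative fun01 x s) (at s within {0..1})"
      if "s \<in> {0..1}" for s
      using integral_has_vector_derivative[OF continuous_on_fun01 that]
      by (simp add: has_real_derivative_iff_has_vector_derivative)
    then show ?thesis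
      using smooth_on_fun01[of x] unfolding Suc smooth_on_def ndiff_on.simps by blast
  qed simp
  then show ?thesis
    unfolding integral_op_def using assms by (simp add: fun01_restrict01 smooth_on_def)
qed

lemma deriv_op_integral_op: "deriv_op (integral_op x) = x"
proof (rule deriv_op_eqI)
  fix t :: real
  assume t: "t \<in> {0..1}"
  have "((\<lambda>t. integral {0..t} (fun01 x)) has_real_derivative fun01 x t) (at t within {0..1})"
    using integral_has_vector_derivative[OF continuous_on_fun01 t]
    by (simp add: has_real_derivative_iff_has_vector_derivative)
  then show "(fun01 (integral_op x) has_real_derivative fun01 x t) (at t within {0..1})"
    by (rule has_field_derivative_transform_within[OF _ zero_less_one t])
       (simp add: fun01_integral_op)
qed

lemma fun01_integral_op_0: "fun01 (integral_op x) 0 = 0"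
  by (simp add: fun01_integral_op)

lemma const_op_plus_integral_op_deriv_op: "const_op x + integral_op (deriv_op x) = x"
  by (rule smooth_fun01_eqI_deriv_op)
     (simp_all add: linear_add[OF linear_deriv_op] deriv_op_const_op deriv_op_integral_op
       plus_smooth_fun01.rep_eq fun01_const_op fun01_integral_op_0)

lemma linear_const_op: "linear const_op"
  by (rule linearI; rule smooth_fun01_eqI) (simp_all add: fun01_simps fun01_const_op)

lemma linear_integral_op: "linear integral_op"
  by (rule linearI; rule smooth_fun01_eqI_deriv_op)
     (simp_all add: linear_add[OF linear_deriv_op] linear_scale[OF linear_deriv_op]
       deriv_op_integral_op fun01_integral_op_0 fun01_simps)

lemma cnorm_const_op_le: "cnorm k (const_op x) \<le> cnorm 0 x"
proof -
  have "cnorm 0 (const_op x) \<le> cnorm 0 x"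
    by (simp add: cnorm_0_le_iff fun01_const_op abs_fun01_le_cnorm)
  then show ?thesis
    by (cases k) (simp_all add: cnorm_Suc_le_iff deriv_op_const_op cnorm_nonneg)
qed

lemma cnorm_Suc_integral_op_le: "cnorm (Suc k) (integral_op x) \<le> cnorm k x"
proof -
  have "\<bar>fun01 (integral_op x) t\<bar> \<le> cnorm k x" if t: "t \<in> {0..1}" for t
  proof -
    have "norm (integral {0..t} (fun01 x)) \<le> cnorm k x * (t - 0)"
      using t by (intro integral_bound continuous_on_subset[OF continuous_on_fun01])
        (auto intro: abs_fun01_le_cnorm)
    also have "\<dots> \<le> cnorm k x * 1"
      using t by (intro mult_left_mono) (auto simp: cnorm_nonneg)
    finally show ?thesis
      using t by (simp add: fun01_integral_op)
  qed
  then show ?thesis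
    by (simp add: cnorm_Suc_le_iff cnorm_0_le_iff deriv_op_integral_op)
qed

lemma continuous_deriv_op: "continuous_on UNIV deriv_op"
proof (rule continuous_on_linear_smooth_fun01[OF linear_deriv_op])
  fix k
  have "cnorm k (deriv_op x) \<le> 1 * cnorm (Suc k) x" for x
    using cnorm_deriv_op_le by simp
  then show "\<exists>l C. \<forall>x. cnorm k (deriv_op x) \<le> C * cnorm l x"
    by blast
qed

lemma continuous_const_op: "continuous_on UNIV const_op"
proof (rule continuous_on_linear_smooth_fun01[OF linear_const_op])
  fix k
  have "cnorm k (const_op x) \<le> 1 * cnorm 0 x" for x
    using cnorm_const_op_le by simp
  then show "\<exists>l C. \<forall>x. cnorm k (const_op x) \<le> C * cnorm l x"
    by blast
qed

lemma continuous_integral_op: "continuous_on UNIV integral_op"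
proof (rule continuous_on_linear_smooth_fun01[OF linear_integral_op])
  fix k
  have "cnorm k (integral_op x) \<le> 1 * cnorm k x" for x
    using cnorm_mono[of k "Suc k" "integral_op x"] cnorm_Suc_integral_op_le[of k x] by simp
  then show "\<exists>l C. \<forall>x. cnorm k (integral_op x) \<le> C * cnorm l x"
    by blast
qed

text \<open>A ball of the norm of order \<open>k\<close> restricts the derivatives up to order \<open>k\<close>, while a superposition
  operator with a bounded function only bounds the values.  Therefore \<open>h\<close> is applied to the coordinates
  \<open>x 0\<close>, \<open>x' 0\<close>, up to the derivative of order \<open>k - 1\<close> at \<open>0\<close>, and to the whole derivative of
  order \<open>k\<close>; then the function is reassembled by repeated integration.  For \<open>h\<close> the
  identity this would give \<open>x\<close> back.\<close>

fun cutoff :: "(real \<Rightarrow> real) \<Rightarrow> nat \<Rightarrow> smooth_fun01 \<Rightarrow> smooth_fun01" where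
  "cutoff h 0 x = superpose h x"
| "cutoff h (Suc k) x = const_op (superpose h x) + integral_op (cutoff h k (deriv_op x))"

lemma cutoff_eq_self:
  assumes h: "smooth_on UNIV h" "\<And>s. \<bar>s\<bar> \<le> d \<Longrightarrow> h s = s"
  shows "cnorm k x \<le> d \<Longrightarrow> cutoff h k x = x"
proof (induction k arbitrary: x)
  case 0
  then show ?case
    by (intro smooth_fun01_eqI) (simp add: fun01_superpose h cnorm_0_le_iff)
next
  case (Suc k)
  then have "cnorm 0 x \<le> d" "cnorm k (deriv_op x) \<le> d"
    by (simp_all add: cnorm_Suc_le_iff)
  moreover from this(1) have "superpose h x = x"
    by (intro smooth_fun01_eqI) (simp add: fun01_superpose h cnorm_0_le_iff)
  ultimately show ?case
    using Suc.IH by (simp add: const_op_plus_integral_op_deriv_op)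
qed

text \<open>Integration does not increase the norms and gains one order; each level adds a constant of
  size at most \<open>c\<close>.\<close>

lemma cnorm_cutoff_le:
  assumes h: "smooth_on UNIV h" "\<And>s. \<bar>h s\<bar> \<le> c"
  shows "cnorm k (cutoff h k x) \<le> real (Suc k) * c"
proof (induction k arbitrary: x)
  case 0
  show ?case
    by (simp add: cnorm_0_le_iff fun01_superpose h)
next
  case (Suc k)
  have "cnorm 0 (superpose h x) \<le> c"
    by (simp add: cnorm_0_le_iff fun01_superpose h)
  then show ?case
    using cnorm_triangle[of "Suc k" "const_op (superpose h x)" "integral_op (cutoff h k (deriv_op x))"]
      cnorm_const_op_le[of "Suc k" "superpose h x"]
      cnorm_Suc_integral_op_le[of k "cutoff h k (deriv_op x)"] Suc.IH[of "deriv_op x"]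
    by (simp add: algebra_simps)
qed

lemma bounded_differentiable_cutoff:
  assumes h: "smooth_on UNIV h"
  shows "bounded_differentiable_at (cutoff h k) x"
proof (induction k arbitrary: x)
  case 0
  then show ?case
    using bounded_differentiable_superpose[OF h] by (simp add: cutoff.simps(1)[abs_def])
next
  case (Suc k)
  have "bounded_differentiable_at (\<lambda>x. cutoff h k (deriv_op x)) x"
    by (intro bounded_differentiable_at_compose[OF _ Suc]
        bounded_differentiable_at_linear linear_deriv_op continuous_deriv_op)
  then have "bounded_differentiable_at (\<lambda>x. integral_op (cutoff h k (deriv_op x))) x"
    by (rule bounded_differentiable_at_compose)
       (intro bounded_differentiable_at_linear linear_integral_op continuous_integral_op)
  moreover have "bounded_differentiable_at (\<lambda>x. const_op (superpose h x)) x"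
    by (intro bounded_differentiable_at_compose[OF bounded_differentiable_superpose[OF h]]
        bounded_differentiable_at_linear linear_const_op continuous_const_op)
  ultimately have "bounded_differentiable_at
      (\<lambda>x. const_op (superpose h x) + integral_op (cutoff h k (deriv_op x))) x"
    by (intro bounded_differentiable_at_add)
  then show ?case
    by simp
qed

text \<open>A neighbourhood of the origin contains a ball of a single norm.  Choosing the bound \<open>c\<close> small
  in terms of its order \<open>k\<close> keeps the values of the cutoff in this ball.\<close>

lemma exists_bounded_differentiable_localization:
  fixes U :: "smooth_fun01 set"
  assumes "open U" "0 \<in> U"
  obtains H where "\<And>x. H x \<in> U" "\<forall>\<^sub>F x in nhds 0. H x = x"
    "\<And>x. bounded_differentiable_at H x"
proof -
  obtain k e where e: "e > 0" and U: "\<And>y. cnorm k y < e \<Longrightarrow> y \<in> U"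
    using assms unfolding open_smooth_fun01_def by force
  define c where "c = e / (2 * real (Suc k))"
  have "c > 0"
    using e by (simp add: c_def)
  then obtain h where h: "smooth_on UNIV h" "\<And>s. \<bar>h s\<bar> \<le> c" "\<And>s. \<bar>s\<bar> \<le> c / 2 \<Longrightarrow> h s = s"
    using exists_smooth_cutoff by blast
  show ?thesis
  proof (rule that[of "cutoff h k"])
    show "cutoff h k x \<in> U" for x
    proof (rule U)
      have "real (Suc k) * c = e / 2"
        by (simp add: c_def field_simps)
      then show "cnorm k (cutoff h k x) < e"
        using cnorm_cutoff_le[OF h(1,2), of k x] e by linarith
    qed
    have "\<forall>\<^sub>F x in nhds 0. x \<in> {y. cnorm k (y - 0) < c / 2}"
      by (rule eventually_nhds_in_open[OF open_cnorm_ball]) (use \<open>c > 0\<close> in simp)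
    then show "\<forall>\<^sub>F x in nhds 0. cutoff h k x = x"
      by (rule eventually_mono) (auto intro!: cutoff_eq_self[OF h(1,3)])
    show "bounded_differentiable_at (cutoff h k) x" for x
      by (rule bounded_differentiable_cutoff[OF h(1)])
  qed
qed


section \<open>Global representatives of germs\<close>

text \<open>Composition with a map into the domain that fixes the points near the origin yields a global map
  with the same germ.\<close>

lemma germ_member_compose_localization:
  fixes G :: "(smooth_fun01 \<rightharpoonup> 'y::real_tvs) set"
  assumes G: "G \<in> germs_at_0" and f: "f \<in> G" "open (dom f)"
  obtains H where "range H \<subseteq> dom f" "(\<lambda>x. f (H x)) \<in> G"
    "\<And>x. bounded_differentiable_at H x"
proof -
  have f0: "f \<in> local_maps_at_0"
    using in_quotient_imp_subset[OF equiv_germ_rel] G f(1) unfolding germs_at_0_def by blast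
  then have "0 \<in> dom f"
    unfolding local_maps_at_0_def by (blast dest: eventually_nhds_x_imp_x)
  with f(2) obtain H where H: "\<And>x. H x \<in> dom f" "\<forall>\<^sub>F x in nhds 0. H x = x"
    "\<And>x. bounded_differentiable_at H x"
    using exists_bounded_differentiable_localization by blast
  have "x \<in> dom (\<lambda>x. f (H x))" for x
    using H(1)[of x] by (simp add: dom_def)
  then have "(\<lambda>x. f (H x)) \<in> local_maps_at_0"
    unfolding local_maps_at_0_def by simp
  moreover have "\<forall>\<^sub>F x in nhds 0. f x = f (H x)"
    using H(2) by eventually_elim simp
  ultimately have "(f, \<lambda>x. f (H x)) \<in> germ_rel"
    using f0 by (simp add: germ_rel_def)
  then have "(\<lambda>x. f (H x)) \<in> G"
    using in_quotient_imp_closed[OF equiv_germ_rel] G f(1) unfolding germs_at_0_def by blast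
  then show ?thesis
    using that H(1,3) by blast
qed

theorem corollary3p10:
  fixes G :: "(smooth_fun01 \<rightharpoonup> 'y::real_tvs) set"
  assumes "G \<in> germs_at_0"
  shows "(bounded_differentiable_germ G \<longrightarrow>
            (\<exists>f\<in>G. global_map f \<and> bounded_differentiable_map f)) \<and>
         (compact_differentiable_germ G \<longrightarrow>
            (\<exists>f\<in>G. global_map f \<and> compact_differentiable_map f))"
proof (intro conjI impI)
  assume "bounded_differentiable_germ G"
  then obtain f where f: "f \<in> G" "open (dom f)"
    "\<And>x. x \<in> dom f \<Longrightarrow> bounded_differentiable_at (\<lambda>y. the (f y)) x"
    unfolding bounded_differentiable_germ_def bounded_differentiable_map_def by blast
  obtain H where H: "range H \<subseteq> dom f" "(\<lambda>x. f (H x)) \<in> G"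
    "\<And>x. bounded_differentiable_at H x"
    using germ_member_compose_localization[OF assms f(1,2)] by blast
  have dom: "dom (\<lambda>x. f (H x)) = UNIV"
    using H(1) by (auto simp: dom_def)
  have "bounded_differentiable_at (\<lambda>x. the (f (H x))) x" for x
    by (rule bounded_differentiable_at_compose[OF H(3) f(3)]) (use H(1) in blast)
  then show "\<exists>f\<in>G. global_map f \<and> bounded_differentiable_map f"
    using dom H(2) unfolding global_map_def bounded_differentiable_map_def
    by (intro bexI[of _ "\<lambda>x. f (H x)"]) auto
next
  assume "compact_differentiable_germ G"
  then obtain f where f: "f \<in> G" "open (dom f)"
    "\<And>x. x \<in> dom f \<Longrightarrow> compact_differentiable_at (\<lambda>y. the (f y)) x"
    unfolding compact_differentiable_germ_def compact_differentiable_map_def by blast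
  obtain H where H: "range H \<subseteq> dom f" "(\<lambda>x. f (H x)) \<in> G"
    "\<And>x. bounded_differentiable_at H x"
    using germ_member_compose_localization[OF assms f(1,2)] by blast
  have dom: "dom (\<lambda>x. f (H x)) = UNIV"
    using H(1) by (auto simp: dom_def)
  have "compact_differentiable_at (\<lambda>x. the (f (H x))) x" for x
    by (rule compact_differentiable_at_compose[OF bounded_imp_compact_differentiable_at[OF H(3)] f(3)])
       (use H(1) in blast)
  then show "\<exists>f\<in>G. global_map f \<and> compact_differentiable_map f"
    using dom H(2) unfolding global_map_def compact_differentiable_map_def
    by (intro bexI[of _ "\<lambda>x. f (H x)"]) auto
qed

end
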